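(* For all positive integers $n,r$ with $n\ge 2r+1$ and every prime power $q$, both the Kneser graph $K_{n:r}$ and the $q$-Kneser graph $qK_{n:r}$ are uniquely vector colorable.
   Context: The Kneser graph $K_{n:r}$ has as vertices the $r$-subsets of $[n]$, adjacent when disjoint; the $q$-Kneser graph $qK_{n:r}$ has as vertices the $r$-dimensional subspaces of $\mathbb F_q^n$, adjacent when they intersect trivially. For $t\ge2$, a vector $t$-coloring of a graph $G=([n],E)$ is an assignment of real unit vectors $p_1,\dots,p_n$ to its vertices with $p_i^Tp_j\le -1/(t-1)$ for all edges $ij$. The vector chromatic number $\chi_v(G)$ of a nonempty graph is the minimum $t\ge2$ such that $G$ has a vector $t$-coloring; a vector coloring is optimal if it is a vector $\chi_v(G)$-coloring. $G$ is uniquely vector colorable if any two optimal vector colorings $\mathbf p,\mathbf q$ have $\mathrm{Gram}(p_1,\dots,p_n)=\mathrm{Gram}(q_1,\dots,q_n)$ (the matrices of pairwise inner products). *)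

theory Defs
  imports
    "HOL-Analysis.Analysis"
    "HOL-Number_Theory.Prime_Powers"
    "Graph_Theory.Pair_Digraph"
begin

(* Finite simple graphs are represented as in Graph_Theory by their sets of vertices and of
   (symmetric) arcs, that is, as elements of the locale pair_graph. *)

definition kneser_graph :: "nat \<Rightarrow> nat \<Rightarrow> nat set pair_pre_digraph" where
  "kneser_graph n r =
     (let V = {S. S \<subseteq> {1..n} \<and> card S = r}
      in \<lparr> pverts = V, parcs = {(S, T). S \<in> V \<and> T \<in> V \<and> S \<inter> T = {}} \<rparr>)"

(* The field with q elements is any type 'f with CARD('f) = q, and the ambient space is
   'f ^ 'n with CARD('n) = n. Here vec.subspace and vec.dim refer to the vector space
   structure over 'f; the unqualified subspace and dim are those over the reals. *)

definition q_kneser_graph ::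
    "nat \<Rightarrow> (('f :: {field, finite}) ^ 'n :: finite) set pair_pre_digraph" where
  "q_kneser_graph r =
     (let V = {U. vec.subspace U \<and> vec.dim U = r}
      in \<lparr> pverts = V, parcs = {(U, W). U \<in> V \<and> W \<in> V \<and> U \<inter> W = {0}} \<rparr>)"

(* Vectors of R^d are functions on nat of which only the values below d matter. This lets the
   dimension be quantified: it is not bounded in the definition of a vector coloring, and two
   colorings that are compared may live in different dimensions. *)

definition dot :: "nat \<Rightarrow> (nat \<Rightarrow> real) \<Rightarrow> (nat \<Rightarrow> real) \<Rightarrow> real" where
  "dot d x y = (\<Sum>i<d. x i * y i)"

definition vector_coloring ::
    "'v pair_pre_digraph \<Rightarrow> real \<Rightarrow> nat \<Rightarrow> ('v \<Rightarrow> nat \<Rightarrow> real) \<Rightarrow> bool" where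
  "vector_coloring G t d p \<longleftrightarrow>
     2 \<le> t \<and>
     (\<forall>u \<in> pverts G. dot d (p u) (p u) = 1) \<and>
     (\<forall>(u, v) \<in> parcs G. dot d (p u) (p v) \<le> - 1 / (t - 1))"

(* The minimum exists for every finite simple graph, since the Gram matrices of unit vectors
   indexed by the vertices form a compact set. *)

definition vector_chromatic_number :: "'v pair_pre_digraph \<Rightarrow> real" where
  "vector_chromatic_number G = (LEAST t. \<exists>d p. vector_coloring G t d p)"

definition optimal_vector_coloring ::
    "'v pair_pre_digraph \<Rightarrow> nat \<Rightarrow> ('v \<Rightarrow> nat \<Rightarrow> real) \<Rightarrow> bool" where
  "optimal_vector_coloring G d p \<longleftrightarrow> vector_coloring G (vector_chromatic_number G) d p"

definition uniquely_vector_colorable :: "'v pair_pre_digraph \<Rightarrow> bool" where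
  "uniquely_vector_colorable G \<longleftrightarrow>
     (\<forall>d p d' p'. optimal_vector_coloring G d p \<and> optimal_vector_coloring G d' p' \<longrightarrow>
        (\<forall>u \<in> pverts G. \<forall>v \<in> pverts G. dot d (p u) (p v) = dot d' (p' u) (p' v)))"

lemma pair_graph_kneser_graph:
  assumes "0 < r"
  shows "pair_graph (kneser_graph n r)"
proof -
  let ?V = "{S. S \<subseteq> {1..n} \<and> card S = r}"
  have V: "finite ?V" by simp
  have "parcs (kneser_graph n r) \<subseteq> ?V \<times> ?V"
    unfolding kneser_graph_def Let_def by auto
  then have "finite (parcs (kneser_graph n r))"
    using V by (meson finite_SigmaI finite_subset)
  moreover have "finite (pverts (kneser_graph n r))"
    using V by (simp add: kneser_graph_def Let_def)
  moreover have "sym (parcs (kneser_graph n r))"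
    unfolding kneser_graph_def Let_def sym_def by auto
  moreover have "fst e \<in> pverts (kneser_graph n r)" "snd e \<in> pverts (kneser_graph n r)"
    if "e \<in> parcs (kneser_graph n r)" for e
    using that by (simp_all add: kneser_graph_def Let_def case_prod_beta)
  moreover have "fst e \<noteq> snd e" if "e \<in> parcs (kneser_graph n r)" for e
  proof
    assume "fst e = snd e"
    with that have "fst e = {} \<and> card (fst e) = r"
      unfolding kneser_graph_def Let_def case_prod_beta by force
    with assms show False by (metis card.empty less_irrefl)
  qed
  ultimately show ?thesis
    by unfold_locales (simp_all add: symmetric_def)
qed

lemma pair_graph_q_kneser_graph:
  assumes "0 < r"
  shows "pair_graph
    (q_kneser_graph r :: (('f :: {field, finite}) ^ 'n :: finite) set pair_pre_digraph)"
    (is "pair_graph ?G")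
proof -
  have zero: "vec.dim {0 :: 'f ^ 'n} = 0"
    by simp
  have "sym (parcs ?G)"
    unfolding q_kneser_graph_def Let_def sym_def by auto
  moreover have "fst e \<in> pverts ?G" "snd e \<in> pverts ?G" if "e \<in> parcs ?G" for e
    using that by (simp_all add: q_kneser_graph_def Let_def case_prod_beta)
  moreover have "fst e \<noteq> snd e" if "e \<in> parcs ?G" for e
  proof
    assume "fst e = snd e"
    with that have "fst e = {0} \<and> vec.dim (fst e) = r"
      unfolding q_kneser_graph_def Let_def case_prod_beta by force
    with assms zero show False by (metis less_irrefl)
  qed
  ultimately show ?thesis
    by unfold_locales (simp_all add: symmetric_def)
qed

end

theory Submission
  imports Defs
begin

text \<open>
  Subsets of a finite set (\<open>q = 1\<close>) and subspaces of \<open>F\<^sub>q\<^sup>n\<close> are treated uniformly as the flats of a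
  geometry with a modular rank in which the number of points of a flat depends only on its rank.
  Every function on the flats of rank \<open>r\<close> is a sum of lifts of harmonic functions on the flats of
  ranks \<open>i \<le> r\<close>, and these lifts are eigenvectors of the disjointness graph. If \<open>n \<ge> 2 * r + 1\<close>, the
  eigenvalues alternate in sign and strictly decrease in absolute value, so the least one belongs to
  \<open>i = 1\<close> only. Hence the coordinates of an optimal coloring lie in that eigenspace, that is,
  \<open>p S = (\<Sum>P\<subseteq>S. c P)\<close> for vectors \<open>c P\<close> attached to the points (rank-one flats) with sum zero, and
  all edges have the same inner product. The invertibility of the incidence matrix of points and
  hyperplanes of a flat of rank \<open>r + 1\<close>, applied twice, turns the latter into the value of
  \<open>c P \<bullet> c Q\<close> for all \<open>P \<noteq> Q\<close>, and the sum zero condition gives \<open>c P \<bullet> c P\<close>.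
\<close>

subsection \<open>Real linear algebra on finite index sets\<close>

text \<open>Gram-Schmidt on the columns of \<open>M\<close>: the projections onto the earlier
  columns are removed from \<open>f\<close> and from the new column, then the component of the
  former along the latter. The columns may be dependent.\<close>

lemma orthogonal_residual:
  fixes M :: "'a \<Rightarrow> 'b \<Rightarrow> real"
  assumes "finite A" "finite C"
  shows "\<exists>h. \<forall>c\<in>C. (\<Sum>a\<in>A. (f a - (\<Sum>b\<in>C. M a b * h b)) * M a c) = 0"
  using assms(2)
proof (induction C arbitrary: f)
  case empty
  then show ?case by simp
next
  case (insert c C)
  obtain h0 where h0: "\<And>b. b \<in> C \<Longrightarrow> (\<Sum>a\<in>A. (f a - (\<Sum>b\<in>C. M a b * h0 b)) * M a b) = 0"
    using insert.IH[of f] by blast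
  obtain k0 where k0: "\<And>b. b \<in> C \<Longrightarrow> (\<Sum>a\<in>A. (M a c - (\<Sum>b\<in>C. M a b * k0 b)) * M a b) = 0"
    using insert.IH[of "\<lambda>a. M a c"] by blast
  define f' where "f' a = f a - (\<Sum>b\<in>C. M a b * h0 b)" for a
  define m' where "m' a = M a c - (\<Sum>b\<in>C. M a b * k0 b)" for a
  \<comment> \<open>If \<open>m'\<close> vanishes on \<open>A\<close>, division by zero makes
    \<open>t\<close> zero; the new column then lies in the span of the earlier ones and needs no
    correction.\<close>
  define t where "t = (\<Sum>a\<in>A. f' a * m' a) / (\<Sum>a\<in>A. m' a * m' a)"
  define h where "h b = (if b = c then t else h0 b - t * k0 b)" for b
  have res: "f a - (\<Sum>b\<in>insert c C. M a b * h b) = f' a - t * m' a" for a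
  proof -
    have "(\<Sum>b\<in>C. M a b * h b) = (\<Sum>b\<in>C. M a b * h0 b - t * (M a b * k0 b))"
      using insert.hyps by (intro sum.cong) (auto simp: h_def algebra_simps)
    then show ?thesis
      using insert.hyps
      by (simp add: f'_def m'_def h_def sum_subtractf sum_distrib_left[symmetric] algebra_simps)
  qed
  have orthC: "(\<Sum>a\<in>A. (f' a - t * m' a) * M a b) = 0" if "b \<in> C" for b
  proof -
    have "(\<Sum>a\<in>A. f' a * M a b) = 0" "(\<Sum>a\<in>A. m' a * M a b) = 0"
      using h0 k0 that by (simp_all add: f'_def m'_def)
    moreover have "(\<Sum>a\<in>A. (f' a - t * m' a) * M a b)
        = (\<Sum>a\<in>A. f' a * M a b) - t * (\<Sum>a\<in>A. m' a * M a b)"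
      by (simp add: algebra_simps sum_subtractf sum_distrib_left)
    ultimately show ?thesis by simp
  qed
  have orthm: "(\<Sum>a\<in>A. (f' a - t * m' a) * m' a) = 0"
  proof (cases "(\<Sum>a\<in>A. m' a * m' a) = 0")
    case True
    then have "\<forall>a\<in>A. m' a = 0"
      using sum_nonneg_eq_0_iff[OF assms(1), of "\<lambda>a. m' a * m' a"] by simp
    then show ?thesis by simp
  next
    case False
    have "(\<Sum>a\<in>A. (f' a - t * m' a) * m' a) = (\<Sum>a\<in>A. f' a * m' a) - t * (\<Sum>a\<in>A. m' a * m' a)"
      by (simp add: algebra_simps sum_subtractf sum_distrib_left)
    then show ?thesis using False by (simp add: t_def)
  qed
  have orthc: "(\<Sum>a\<in>A. (f' a - t * m' a) * M a c) = 0"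
  proof -
    have "(\<Sum>a\<in>A. (f' a - t * m' a) * M a c)
        = (\<Sum>a\<in>A. (f' a - t * m' a) * m' a + (\<Sum>b\<in>C. (f' a - t * m' a) * M a b * k0 b))"
    proof (rule sum.cong[OF refl])
      fix a
      have "M a c = m' a + (\<Sum>b\<in>C. M a b * k0 b)" by (simp add: m'_def)
      then have "(f' a - t * m' a) * M a c
          = (f' a - t * m' a) * m' a + (f' a - t * m' a) * (\<Sum>b\<in>C. M a b * k0 b)"
        by (simp only: distrib_left)
      then show "(f' a - t * m' a) * M a c
          = (f' a - t * m' a) * m' a + (\<Sum>b\<in>C. (f' a - t * m' a) * M a b * k0 b)"
        by (simp only: sum_distrib_left mult.assoc)
    qed
    also have "\<dots> = (\<Sum>b\<in>C. k0 b * (\<Sum>a\<in>A. (f' a - t * m' a) * M a b))"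
      unfolding sum.distrib orthm by (subst sum.swap) (simp add: sum_distrib_left mult.commute)
    finally show ?thesis using orthC by simp
  qed
  show ?case
    using orthC orthc by (intro exI[of _ h]) (simp add: res del: sum.insert)
qed

text \<open>Eigenvectors of a symmetric matrix for distinct eigenvalues are orthogonal, so the form
  minus \<open>lam m\<close> times the squared norm is the sum of \<open>lam i - lam m\<close> times
  the squared norm of \<open>F i\<close>. No term is negative, and equality kills all components
  except \<open>F m\<close>.\<close>

lemma sum_of_eigenvectors_bound:
  fixes a :: "'v \<Rightarrow> 'v \<Rightarrow> real"
  assumes fin: "finite V" "finite I"
    and sym: "\<And>u v. a u v = a v u"
    and ev: "\<And>i u. i \<in> I \<Longrightarrow> u \<in> V \<Longrightarrow> (\<Sum>v\<in>V. a u v * F i v) = lam i * F i u"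
    and inj: "inj_on lam I"
    and f: "\<And>u. u \<in> V \<Longrightarrow> f u = (\<Sum>i\<in>I. F i u)"
    and m: "m \<in> I" "\<And>i. i \<in> I \<Longrightarrow> i \<noteq> m \<Longrightarrow> lam m < lam i"
  shows "lam m * (\<Sum>u\<in>V. f u * f u) \<le> (\<Sum>u\<in>V. \<Sum>v\<in>V. a u v * (f u * f v))"
    and "(\<Sum>u\<in>V. \<Sum>v\<in>V. a u v * (f u * f v)) = lam m * (\<Sum>u\<in>V. f u * f u)
      \<Longrightarrow> u \<in> V \<Longrightarrow> f u = F m u"
proof -
  define ip where "ip i j = (\<Sum>u\<in>V. F i u * F j u)" for i j
  have orth: "ip i j = 0" if "i \<in> I" "j \<in> I" "i \<noteq> j" for i j
  proof -
    have "lam i * ip i j = (\<Sum>u\<in>V. (\<Sum>v\<in>V. a u v * F i v) * F j u)"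
      by (simp add: ip_def ev that sum_distrib_left mult.assoc)
    also have "\<dots> = (\<Sum>v\<in>V. (\<Sum>u\<in>V. a v u * F j u) * F i v)"
      unfolding sum_distrib_right
      by (subst sum.swap) (intro sum.cong refl, simp add: mult_ac sym)
    also have "\<dots> = lam j * ip i j"
      by (simp add: ip_def ev that) (simp add: sum_distrib_left mult_ac)
    finally show ?thesis using inj_onD[OF inj] that by auto
  qed
  have diag: "(\<Sum>i\<in>I. \<Sum>j\<in>I. c j * ip i j) = (\<Sum>i\<in>I. c i * ip i i)" for c
  proof (rule sum.cong[OF refl])
    fix i assume "i \<in> I"
    then have "(\<Sum>j\<in>I. c j * ip i j) = (\<Sum>j\<in>I. if j = i then c i * ip i i else 0)"
      using orth by (intro sum.cong) auto
    then show "(\<Sum>j\<in>I. c j * ip i j) = c i * ip i i" using \<open>i \<in> I\<close> fin by simp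
  qed
  have nsq: "(\<Sum>u\<in>V. f u * f u) = (\<Sum>i\<in>I. ip i i)"
  proof -
    have "(\<Sum>u\<in>V. f u * f u) = (\<Sum>u\<in>V. \<Sum>i\<in>I. \<Sum>j\<in>I. F i u * F j u)"
      by (simp add: f sum_product)
    also have "\<dots> = (\<Sum>i\<in>I. \<Sum>j\<in>I. ip i j)"
      unfolding ip_def by (subst sum.swap) (intro sum.cong refl sum.swap)
    finally show ?thesis using diag[of "\<lambda>_. 1"] by simp
  qed
  have form: "(\<Sum>u\<in>V. \<Sum>v\<in>V. a u v * (f u * f v)) = (\<Sum>i\<in>I. lam i * ip i i)"
  proof -
    have "(\<Sum>u\<in>V. \<Sum>v\<in>V. a u v * (f u * f v)) = (\<Sum>u\<in>V. f u * (\<Sum>v\<in>V. a u v * f v))"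
      by (simp add: sum_distrib_left mult_ac)
    also have "\<dots> = (\<Sum>u\<in>V. (\<Sum>i\<in>I. F i u) * (\<Sum>j\<in>I. lam j * F j u))"
    proof (rule sum.cong[OF refl])
      fix u assume u: "u \<in> V"
      have "(\<Sum>v\<in>V. a u v * f v) = (\<Sum>j\<in>I. \<Sum>v\<in>V. a u v * F j v)"
        by (subst sum.swap) (simp add: f sum_distrib_left)
      then show "f u * (\<Sum>v\<in>V. a u v * f v) = (\<Sum>i\<in>I. F i u) * (\<Sum>j\<in>I. lam j * F j u)"
        using u by (simp add: f ev)
    qed
    also have "\<dots> = (\<Sum>u\<in>V. \<Sum>i\<in>I. \<Sum>j\<in>I. lam j * (F i u * F j u))"
      by (simp add: sum_product mult_ac)
    also have "\<dots> = (\<Sum>i\<in>I. \<Sum>j\<in>I. \<Sum>u\<in>V. lam j * (F i u * F j u))"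
      by (subst sum.swap) (intro sum.cong refl sum.swap)
    also have "\<dots> = (\<Sum>i\<in>I. \<Sum>j\<in>I. lam j * ip i j)"
      by (simp add: ip_def sum_distrib_left)
    finally show ?thesis using diag by simp
  qed
  have diff: "(\<Sum>u\<in>V. \<Sum>v\<in>V. a u v * (f u * f v)) - lam m * (\<Sum>u\<in>V. f u * f u)
      = (\<Sum>i\<in>I. (lam i - lam m) * ip i i)"
    by (simp add: nsq form sum_distrib_left sum_subtractf left_diff_distrib)
  have ip_nonneg: "0 \<le> ip i i" for i by (simp add: ip_def sum_nonneg)
  have nonneg: "0 \<le> (lam i - lam m) * ip i i" if "i \<in> I" for i
    using ip_nonneg m that by (cases "i = m") (auto intro!: mult_nonneg_nonneg simp: less_imp_le)
  show "lam m * (\<Sum>u\<in>V. f u * f u) \<le> (\<Sum>u\<in>V. \<Sum>v\<in>V. a u v * (f u * f v))"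
    using diff sum_nonneg[of I "\<lambda>i. (lam i - lam m) * ip i i"] nonneg by simp
  assume eq: "(\<Sum>u\<in>V. \<Sum>v\<in>V. a u v * (f u * f v)) = lam m * (\<Sum>u\<in>V. f u * f u)"
    and u: "u \<in> V"
  have "F i u = 0" if "i \<in> I" "i \<noteq> m" for i
  proof -
    have "(lam i - lam m) * ip i i = 0"
      using diff eq sum_nonneg_eq_0_iff[OF fin(2), of "\<lambda>i. (lam i - lam m) * ip i i"] nonneg that
      by simp
    then have "ip i i = 0" using m that by force
    then have "\<forall>u\<in>V. F i u * F i u = 0"
      unfolding ip_def using sum_nonneg_eq_0_iff[OF fin(1), of "\<lambda>u. F i u * F i u"] by simp
    then show ?thesis using u by simp
  qed
  then have "(\<Sum>i\<in>I. F i u) = (\<Sum>i\<in>I. if i = m then F m u else 0)"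
    by (intro sum.cong) auto
  then show "f u = F m u" using f u fin m by simp
qed

lemma dot_commute: "dot d x y = dot d y x"
  by (simp add: dot_def mult.commute)

lemma dot_sum_left:
  assumes "\<And>l. l < d \<Longrightarrow> x l = (\<Sum>P\<in>X. c P l)"
  shows "dot d x y = (\<Sum>P\<in>X. dot d (c P) y)"
proof -
  have "dot d x y = (\<Sum>l<d. \<Sum>P\<in>X. c P l * y l)"
    by (simp add: dot_def assms sum_distrib_right)
  then show ?thesis by (subst (asm) sum.swap) (simp add: dot_def)
qed

subsection \<open>Modular geometries\<close>

text \<open>
  \<open>L\<close> is the set of flats, \<open>B\<close> and \<open>E\<close> are the least and the greatest flat, and \<open>J\<close> is the join. Flats
  of rank \<open>i\<close> have \<open>s i\<close> elements; for subspaces \<open>s i = q ^ i\<close>, the zero vector included, so each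
  flat of rank one has \<open>w = q - 1\<close> elements outside \<open>B\<close>.
\<close>

locale modular_geometry =
  fixes L :: "'a set set" and B E :: "'a set" and rk :: "'a set \<Rightarrow> nat"
    and J :: "'a set \<Rightarrow> 'a set \<Rightarrow> 'a set" and pt :: "'a \<Rightarrow> 'a set"
    and s :: "nat \<Rightarrow> nat" and w q :: nat
  assumes finite_E: "finite E" and E_in: "E \<in> L" and B_in: "B \<in> L"
    and le_E: "S \<in> L \<Longrightarrow> S \<subseteq> E" and B_le: "S \<in> L \<Longrightarrow> B \<subseteq> S"
    and Int_in: "S \<in> L \<Longrightarrow> T \<in> L \<Longrightarrow> S \<inter> T \<in> L"
    and J_in: "S \<in> L \<Longrightarrow> T \<in> L \<Longrightarrow> J S T \<in> L"
    and J_upper1: "S \<in> L \<Longrightarrow> T \<in> L \<Longrightarrow> S \<subseteq> J S T"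
    and J_upper2: "S \<in> L \<Longrightarrow> T \<in> L \<Longrightarrow> T \<subseteq> J S T"
    and J_least: "S \<in> L \<Longrightarrow> T \<in> L \<Longrightarrow> U \<in> L \<Longrightarrow> S \<subseteq> U \<Longrightarrow> T \<subseteq> U \<Longrightarrow> J S T \<subseteq> U"
    and modular: "S \<in> L \<Longrightarrow> T \<in> L \<Longrightarrow> rk (S \<inter> T) + rk (J S T) = rk S + rk T"
    and rk_B: "rk B = 0"
    and pt_in: "v \<in> E \<Longrightarrow> pt v \<in> L" and pt_self: "v \<in> E \<Longrightarrow> v \<in> pt v"
    and pt_least: "S \<in> L \<Longrightarrow> v \<in> S \<Longrightarrow> pt v \<subseteq> S"
    and rk_pt: "v \<in> E - B \<Longrightarrow> rk (pt v) = 1"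
    and card_flat: "S \<in> L \<Longrightarrow> card S = s (rk S)"
    and s_Suc: "s (Suc i) = s i + w * q ^ i"
    and w_pos: "0 < w" and q_pos: "0 < q"
begin

section \<open>Ranks, adjoining elements, and counts of flats\<close>

lemma finite_flat: "S \<in> L \<Longrightarrow> finite S"
  using finite_E le_E finite_subset by blast

lemma finite_L: "finite L"
  using finite_E le_E by (metis PowI finite_Pow_iff finite_subset subsetI)

lemma strict_mono_s: "strict_mono s"
  using w_pos q_pos by (simp add: strict_mono_Suc_iff s_Suc)

lemma s_less_iff [simp]: "s i < s j \<longleftrightarrow> i < j"
  using strict_mono_s strict_mono_less by blast

lemma s_le_iff [simp]: "s i \<le> s j \<longleftrightarrow> i \<le> j"
  using strict_mono_s strict_mono_less_eq by blast

lemma s_eq_iff [simp]: "s i = s j \<longleftrightarrow> i = j"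
  using strict_mono_s strict_mono_eq by blast

lemma rk_mono: "S \<in> L \<Longrightarrow> T \<in> L \<Longrightarrow> S \<subseteq> T \<Longrightarrow> rk S \<le> rk T"
  using card_flat card_mono finite_flat s_le_iff by metis

lemma flat_eqI: "S \<in> L \<Longrightarrow> T \<in> L \<Longrightarrow> S \<subseteq> T \<Longrightarrow> rk T \<le> rk S \<Longrightarrow> S = T"
  by (metis card_flat card_subset_eq finite_flat le_antisym rk_mono)

lemma eq_B_iff: "S \<in> L \<Longrightarrow> S = B \<longleftrightarrow> rk S = 0"
  using B_in B_le flat_eqI rk_B by (metis le_zero_eq)

lemma rk_strict_mono: "S \<in> L \<Longrightarrow> T \<in> L \<Longrightarrow> S \<subset> T \<Longrightarrow> rk S < rk T"
  using flat_eqI by (metis leI psubsetE subset_refl)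

lemma Int_pt:
  assumes "S \<in> L" "v \<in> E" "v \<notin> S"
  shows "S \<inter> pt v = B"
proof -
  have "v \<in> E - B" using assms B_le by blast
  then have "rk (pt v) = 1" by (rule rk_pt)
  moreover have "S \<inter> pt v \<subset> pt v" using assms pt_self by blast
  ultimately have "rk (S \<inter> pt v) = 0"
    using rk_strict_mono[of "S \<inter> pt v" "pt v"] Int_in pt_in assms by force
  then show ?thesis using eq_B_iff Int_in pt_in assms by blast
qed

text \<open>Not adjacency: the element \<open>v\<close> is adjoined to \<open>S\<close>. Flats are
  enlarged by elements rather than by points because \<open>s\<close> counts elements.\<close>

definition adj :: "'a set \<Rightarrow> 'a \<Rightarrow> 'a set" where
  "adj S v = J S (pt v)"

lemma adj_in: "S \<in> L \<Longrightarrow> v \<in> E \<Longrightarrow> adj S v \<in> L"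
  by (simp add: adj_def J_in pt_in)

lemma adj_upper: "S \<in> L \<Longrightarrow> v \<in> E \<Longrightarrow> S \<subseteq> adj S v"
  by (simp add: adj_def J_upper1 pt_in)

lemma adj_self: "S \<in> L \<Longrightarrow> v \<in> E \<Longrightarrow> v \<in> adj S v"
  using J_upper2 pt_in pt_self unfolding adj_def by blast

lemma adj_least: "S \<in> L \<Longrightarrow> U \<in> L \<Longrightarrow> S \<subseteq> U \<Longrightarrow> v \<in> U \<Longrightarrow> adj S v \<subseteq> U"
  unfolding adj_def by (meson J_least le_E pt_in pt_least subsetD)

lemma rk_adj:
  assumes "S \<in> L" "v \<in> E" "v \<notin> S"
  shows "rk (adj S v) = Suc (rk S)"
proof -
  have "v \<in> E - B" using assms B_le by blast
  then show ?thesis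
    using modular[of S "pt v"] Int_pt[OF assms] rk_pt rk_B pt_in assms by (simp add: adj_def)
qed

definition flats :: "nat \<Rightarrow> 'a set set" where
  "flats k = {S \<in> L. rk S = k}"

lemma finite_flats [simp]: "finite (flats k)"
  using finite_L by (simp add: flats_def)

lemma flats_below_self:
  assumes "S \<in> flats k"
  shows "{P. P \<in> flats k \<and> P \<subseteq> S} = {S}"
proof -
  have "P = S" if "P \<in> flats k" "P \<subseteq> S" for P
    using flat_eqI[of P S] assms that by (simp add: flats_def)
  then show ?thesis using assms by blast
qed

lemma points_Int:
  assumes "P \<in> flats 1" "Q \<in> flats 1" "P \<noteq> Q"
  shows "P \<inter> Q = B"
proof -
  have P: "P \<in> L" "rk P = 1" "Q \<in> L" "rk Q = 1" using assms by (auto simp: flats_def)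
  have I: "P \<inter> Q \<in> L" using Int_in P by blast
  have "\<not> P \<subseteq> Q" using flat_eqI[OF P(1,3)] P assms(3) by auto
  then have "P \<inter> Q \<subset> P" by blast
  then have "rk (P \<inter> Q) < 1" using rk_strict_mono[OF I P(1)] P by simp
  then show ?thesis using eq_B_iff[OF I] by simp
qed

text \<open>For \<open>i \<le> k\<close> and \<open>k + a \<le> m\<close> this is the binomial
  coefficient of \<open>m - a - i\<close> over \<open>k - i\<close> for subsets, and the Gaussian
  one times \<open>q ^ (a * (k - i))\<close> for subspaces. The numerator at \<open>h\<close> counts
  the elements that can be adjoined to a flat of rank \<open>h\<close>, the denominator those lying
  in a given final flat.\<close>

definition cnt :: "nat \<Rightarrow> nat \<Rightarrow> nat \<Rightarrow> nat \<Rightarrow> real" where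
  "cnt k m a i = (\<Prod>h=i..<k. (real (s m) - real (s (h + a))) / (real (s k) - real (s h)))"

lemma cnt_self [simp]: "cnt k m a k = 1"
  by (simp add: cnt_def)

lemma cnt_rec:
  "i < k \<Longrightarrow> cnt k m a i * (real (s k) - real (s i)) = (real (s m) - real (s (i + a))) * cnt k m a (Suc i)"
  unfolding cnt_def by (subst prod.atLeast_Suc_lessThan) auto

lemma cnt_pos: "k + a \<le> m \<Longrightarrow> 0 < cnt k m a i"
  unfolding cnt_def by (intro prod_pos) auto

text \<open>By modularity, adjoining \<open>v \<notin> R\<close> raises either the rank of the join
  with \<open>S\<close> or the rank of the intersection with \<open>S\<close>, but not both; the
  join is unchanged exactly when \<open>v \<in> J R S\<close>.\<close>

lemma adj_Int:
  assumes "R \<in> L" "S \<in> L" "v \<in> E"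
  shows "v \<notin> J R S \<Longrightarrow> adj R v \<inter> S = R \<inter> S"
    and "v \<in> J R S \<Longrightarrow> v \<notin> R \<Longrightarrow> adj R v \<inter> S \<noteq> R \<inter> S"
proof -
  have A: "adj R v \<in> L" using adj_in assms by blast
  have JRS: "J R S \<in> L" using J_in assms by blast
  have m: "rk (R \<inter> S) + rk (J R S) = rk R + rk S"
    "rk (adj R v \<inter> S) + rk (J (adj R v) S) = rk (adj R v) + rk S"
    using modular A assms by auto
  { assume v: "v \<notin> J R S"
    then have "v \<notin> R" using J_upper1 assms by blast
    then have r: "rk (adj R v) = Suc (rk R)" using rk_adj assms by blast
    have "J R S \<subset> J (adj R v) S"
    proof
      show "J R S \<subseteq> J (adj R v) S"
        by (meson A J_in J_least J_upper1 J_upper2 adj_upper assms order_trans)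
      show "J R S \<noteq> J (adj R v) S"
        using v A J_upper1 adj_self assms by blast
    qed
    then have "rk (J R S) < rk (J (adj R v) S)"
      using rk_strict_mono A J_in assms by blast
    then have "rk (adj R v \<inter> S) \<le> rk (R \<inter> S)" using m r by linarith
    then show "adj R v \<inter> S = R \<inter> S"
      using flat_eqI[of "R \<inter> S" "adj R v \<inter> S"] A Int_in adj_upper assms by blast }
  { assume v: "v \<in> J R S" "v \<notin> R"
    then have r: "rk (adj R v) = Suc (rk R)" using rk_adj assms by blast
    have "J (adj R v) S \<subseteq> J R S"
      using v A J_least J_upper1 J_upper2 adj_least assms JRS by metis
    then have "rk (J (adj R v) S) \<le> rk (J R S)"
      using rk_mono A J_in assms by blast
    then have "rk (adj R v \<inter> S) > rk (R \<inter> S)" using m r by linarith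
    then show "adj R v \<inter> S \<noteq> R \<inter> S" by auto }
qed

text \<open>
  Double counting of the pairs \<open>(v, T)\<close> with \<open>v \<in> T - R\<close> reduces \<open>R\<close> to \<open>adj R v\<close>: the admissible
  \<open>v\<close> are exactly those in \<open>Z - J R S\<close>.
\<close>

lemma card_flats_between:
  assumes "R \<in> L" "S \<in> L" "Z \<in> L" "R \<subseteq> Z" "S \<subseteq> Z" "R \<inter> S = Q" "rk S = rk Q + a" "rk R \<le> k"
  shows "real (card {T \<in> flats k. R \<subseteq> T \<and> T \<subseteq> Z \<and> T \<inter> S = Q}) = cnt k (rk Z) a (rk R)"
  using assms
proof (induction "k - rk R" arbitrary: R)
  case 0
  then have k: "k = rk R" by simp
  then have "T = R" if "T \<in> flats k" "R \<subseteq> T" for T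
    using flat_eqI[of R T] 0 that by (simp add: flats_def)
  then have "{T \<in> flats k. R \<subseteq> T \<and> T \<subseteq> Z \<and> T \<inter> S = Q} = {R}"
    using 0 k by (auto simp: flats_def)
  then show ?case using k by simp
next
  case (Suc d)
  let ?X = "{T \<in> flats k. R \<subseteq> T \<and> T \<subseteq> Z \<and> T \<inter> S = Q}"
  let ?V = "Z - J R S"
  have k: "rk R < k" using Suc by simp
  have JL: "J R S \<in> L" "J R S \<subseteq> Z" using Suc.prems J_in J_least by blast+
  have finX: "finite ?X" by simp
  have finV: "finite ?V" using finite_flat Suc.prems by blast
  have vT: "v \<in> ?V \<longleftrightarrow> v \<notin> R" if "T \<in> ?X" "v \<in> T" for T v
  proof
    show "v \<in> ?V \<Longrightarrow> v \<notin> R" using J_upper1 Suc.prems by blast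
    assume v: "v \<notin> R"
    have vE: "v \<in> E" using that le_E unfolding flats_def by blast
    have "T \<in> L" "R \<subseteq> T" using that by (auto simp: flats_def)
    then have "adj R v \<subseteq> T" using adj_least that Suc.prems by blast
    moreover have "R \<inter> S \<subseteq> adj R v \<inter> S" using adj_upper Suc.prems vE by blast
    ultimately have "adj R v \<inter> S = R \<inter> S" using that Suc.prems by blast
    then have "v \<notin> J R S" using adj_Int(2) vE v Suc.prems by blast
    then show "v \<in> ?V" using that by auto
  qed
  have "(\<Sum>T\<in>?X. real (card {v \<in> ?V. v \<in> T})) = (\<Sum>T\<in>?X. real (s k) - real (s (rk R)))"
  proof (rule sum.cong[OF refl])
    fix T assume T: "T \<in> ?X"
    then have "{v \<in> ?V. v \<in> T} = T - R" using vT by auto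
    moreover have "T \<in> L" "rk T = k" "R \<subseteq> T" using T by (auto simp: flats_def)
    then have "card (T - R) = s k - s (rk R)"
      using card_Diff_subset[of R T] finite_flat card_flat Suc.prems(1) by metis
    ultimately show "real (card {v \<in> ?V. v \<in> T}) = real (s k) - real (s (rk R))"
      using k by (simp add: of_nat_diff less_imp_le)
  qed
  moreover have "(\<Sum>T\<in>?X. real (card {v \<in> ?V. v \<in> T})) = (\<Sum>v\<in>?V. real (card {T \<in> ?X. v \<in> T}))"
    using sum.swap_restrict[OF finX finV, of "\<lambda>_ _. 1::real" "\<lambda>T v. v \<in> T"] by simp
  moreover have "(\<Sum>v\<in>?V. real (card {T \<in> ?X. v \<in> T})) = (\<Sum>v\<in>?V. cnt k (rk Z) a (Suc (rk R)))"
  proof (rule sum.cong[OF refl])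
    fix v assume v: "v \<in> ?V"
    have vE: "v \<in> E" using v le_E Suc.prems by blast
    have vR: "v \<notin> R" using v J_upper1 Suc.prems by blast
    have AL: "adj R v \<in> L" using adj_in vE Suc.prems by blast
    have Aeq: "adj R v \<inter> S = Q" using adj_Int(1) v vE Suc.prems by blast
    have AZ: "adj R v \<subseteq> Z" using adj_least v Suc.prems by blast
    have Ar: "rk (adj R v) = Suc (rk R)" using rk_adj vE vR Suc.prems by blast
    have "adj R v \<subseteq> T \<longleftrightarrow> R \<subseteq> T \<and> v \<in> T" if "T \<in> L" for T
      using adj_least[OF Suc.prems(1) that] adj_upper[OF Suc.prems(1) vE]
        adj_self[OF Suc.prems(1) vE] by blast
    then have "{T \<in> ?X. v \<in> T} = {T \<in> flats k. adj R v \<subseteq> T \<and> T \<subseteq> Z \<and> T \<inter> S = Q}"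
      by (auto simp: flats_def)
    then show "real (card {T \<in> ?X. v \<in> T}) = cnt k (rk Z) a (Suc (rk R))"
      using Suc.hyps(1)[OF _ AL Suc.prems(2,3) AZ Suc.prems(5) Aeq Suc.prems(7)] Suc.hyps(2) Ar k by simp
  qed
  moreover have "real (card ?V) = real (s (rk Z)) - real (s (rk R + a))"
  proof -
    have "rk (J R S) = rk R + a" using modular[of R S] Suc.prems by simp
    moreover have "card ?V = card Z - card (J R S)"
      using card_Diff_subset JL finite_flat by blast
    ultimately show ?thesis
      using card_flat[OF JL(1)] card_flat[OF Suc.prems(3)] rk_mono[OF JL(1) Suc.prems(3) JL(2)]
      by (simp add: of_nat_diff)
  qed
  ultimately have "real (card ?X) * (real (s k) - real (s (rk R)))
      = (real (s (rk Z)) - real (s (rk R + a))) * cnt k (rk Z) a (Suc (rk R))"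
    by simp
  then have "real (card ?X) * (real (s k) - real (s (rk R)))
      = cnt k (rk Z) a (rk R) * (real (s k) - real (s (rk R)))"
    using cnt_rec[OF k] by simp
  moreover have "real (s k) - real (s (rk R)) \<noteq> 0" using k by simp
  ultimately show ?case by (rule mult_right_cancel[THEN iffD1, rotated])
qed

lemma card_flats_interval:
  assumes "R \<in> L" "Z \<in> L" "R \<subseteq> Z" "rk R \<le> k"
  shows "real (card {T \<in> flats k. R \<subseteq> T \<and> T \<subseteq> Z}) = cnt k (rk Z) 0 (rk R)"
proof -
  have "{T \<in> flats k. R \<subseteq> T \<and> T \<subseteq> Z} = {T \<in> flats k. R \<subseteq> T \<and> T \<subseteq> Z \<and> T \<inter> B = B}"
    using B_le by (auto simp: flats_def)
  then show ?thesis
    using card_flats_between[of R B Z B 0 k] assms B_in B_le by (simp add: inf_absorb2)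
qed

lemma flat_between_exists:
  assumes "R \<in> L" "S \<in> L" "Z \<in> L" "R \<subseteq> Z" "S \<subseteq> Z" "R \<inter> S = Q" "rk S = rk Q + a"
    "rk R \<le> k" "k + a \<le> rk Z"
  obtains T where "T \<in> L" "rk T = k" "R \<subseteq> T" "T \<subseteq> Z" "T \<inter> S = Q"
proof -
  let ?X = "{T \<in> flats k. R \<subseteq> T \<and> T \<subseteq> Z \<and> T \<inter> S = Q}"
  have "0 < real (card ?X)" using card_flats_between[OF assms(1-8)] cnt_pos[OF assms(9)] by simp
  then have "?X \<noteq> {}" by force
  then show ?thesis using that by (auto simp: flats_def)
qed

subsection \<open>Harmonic functions\<close>

text \<open>Equivalently, \<open>g\<close> is orthogonal on rank \<open>i\<close> to the lifts of
  all functions on lower ranks, where a lift takes at \<open>S\<close> the sum over the flats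
  contained in \<open>S\<close>.\<close>

definition harmonic :: "nat \<Rightarrow> ('a set \<Rightarrow> real) \<Rightarrow> bool" where
  "harmonic i g \<longleftrightarrow> (\<forall>Q\<in>L. rk Q < i \<longrightarrow> (\<Sum>R | R \<in> flats i \<and> Q \<subseteq> R. g R) = 0)"

text \<open>The Moebius function of an interval of length \<open>d\<close>.\<close>

definition mu :: "nat \<Rightarrow> real" where
  "mu d = (\<Prod>h<d. - (real q ^ h))"

text \<open>
  By induction on \<open>S\<close>, one rank at a time: if \<open>S\<close> is a hyperplane of \<open>S'\<close> and \<open>R \<inter> S = Q\<close>, then
  \<open>R \<inter> S'\<close> is \<open>Q\<close> or covers \<open>Q\<close>, and the latter case is governed by \<open>d - 1\<close>.
\<close>

lemma harmonic_disjoint: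
  assumes g: "harmonic i g"
    and "Q \<in> L" "S \<in> L" "Q \<subseteq> S" "rk Q + d = i"
  shows "(\<Sum>R | R \<in> flats i \<and> R \<inter> S = Q. g R)
    = mu d * (\<Sum>R | R \<in> flats i \<and> Q \<subseteq> R \<and> R \<subseteq> S. g R)"
  using assms(2-)
proof (induction d arbitrary: Q S)
  case 0
  have "R = Q" if "R \<in> flats i" "Q \<subseteq> R" for R
    using flat_eqI[of Q R] that 0 by (simp add: flats_def)
  then have "{R. R \<in> flats i \<and> R \<inter> S = Q} = {Q}" "{R. R \<in> flats i \<and> Q \<subseteq> R \<and> R \<subseteq> S} = {Q}"
    using 0 by (auto simp: flats_def)
  then show ?case by (simp add: mu_def)
next
  case (Suc d)
  note IH = Suc.IH
  have "(\<Sum>R | R \<in> flats i \<and> R \<inter> S = Q. g R)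
      = mu (Suc d) * (\<Sum>R | R \<in> flats i \<and> Q \<subseteq> R \<and> R \<subseteq> S. g R)"
    if "S \<in> L" "Q \<subseteq> S" "rk S = rk Q + e" for e S
    using that
  proof (induction e arbitrary: S)
    case 0
    \<comment> \<open>For \<open>S = Q\<close> both sides vanish: the left one by harmonicity, the
      right one because no flat of rank \<open>i\<close> lies in \<open>Q\<close>.\<close>
    then have eq: "Q = S" using Suc.prems by (intro flat_eqI) auto
    have notin: "R \<notin> flats i" if "R \<subseteq> Q" for R
    proof
      assume "R \<in> flats i"
      then have "i \<le> rk Q" using rk_mono[OF _ Suc.prems(1) that] by (auto simp: flats_def)
      then show False using Suc.prems by simp
    qed
    then have none: "{R. R \<in> flats i \<and> Q \<subseteq> R \<and> R \<subseteq> Q} = {}" by blast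
    have above: "{R. R \<in> flats i \<and> R \<inter> Q = Q} = {R. R \<in> flats i \<and> Q \<subseteq> R}" by blast
    have "(\<Sum>R | R \<in> flats i \<and> Q \<subseteq> R. g R) = 0"
      using g Suc.prems unfolding harmonic_def by simp
    then show ?case unfolding eq[symmetric] none above by simp
  next
    case (Suc e S')
    note QL = \<open>Q \<in> L\<close> and rkQ = \<open>rk Q + Suc d = i\<close>
    have S': "S' \<in> L" "Q \<subseteq> S'" "rk S' = Suc (rk Q + e)" using Suc.prems by auto
    obtain S where S: "S \<in> L" "rk S = rk Q + e" "Q \<subseteq> S" "S \<subseteq> S'"
      using flat_between_exists[of Q B S' B 0 "rk Q + e"] QL S' B_in B_le[OF S'(1)] B_le[OF QL]
      by (auto simp: inf_absorb2)
    \<comment> \<open>Besides \<open>Q\<close> itself, these covers of \<open>Q\<close> are the only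
      possible intersections with \<open>S'\<close> of a flat that meets \<open>S\<close> in
      \<open>Q\<close>.\<close>
    define Ps where "Ps = {P \<in> flats (Suc (rk Q)). Q \<subseteq> P \<and> P \<subseteq> S' \<and> P \<inter> S = Q}"
    define Y where "Y = {R. R \<in> flats i \<and> Q \<subseteq> R \<and> R \<subseteq> S'}"
    have finPs: "finite Ps" and finY: "finite Y" by (simp_all add: Ps_def Y_def)
    have Qnot: "Q \<notin> Ps" by (simp add: Ps_def flats_def)
    have trace: "R \<inter> S' \<in> insert Q Ps" if R: "R \<in> flats i" "R \<inter> S = Q" for R
    proof -
      have P: "R \<inter> S' \<in> L" using Int_in R S' by (simp add: flats_def)
      have PS: "R \<inter> S' \<inter> S = Q" using R S by blast
      have QP: "Q \<subseteq> R \<inter> S'" using R S' by blast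
      have JL: "J (R \<inter> S') S \<in> L" "J (R \<inter> S') S \<subseteq> S'"
        using J_in[OF P S(1)] J_least[OF P S(1) S'(1) _ S(4)] by auto
      have "rk (J (R \<inter> S') S) \<le> rk S'" using rk_mono JL S' by blast
      then have "rk (R \<inter> S') \<le> Suc (rk Q)" using modular[OF P S(1)] PS S S' by simp
      moreover have "R \<inter> S' = Q" if "rk (R \<inter> S') \<le> rk Q"
        using flat_eqI[OF QL P QP that] by simp
      ultimately show ?thesis using P PS QP by (auto simp: Ps_def flats_def le_Suc_eq)
    qed
    have "(\<Sum>R | R \<in> flats i \<and> R \<inter> S = Q. g R)
        = (\<Sum>P\<in>insert Q Ps. \<Sum>R | R \<in> {R. R \<in> flats i \<and> R \<inter> S = Q} \<and> R \<inter> S' = P. g R)"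
      using trace finPs by (intro sum.group[symmetric]) auto
    also have "\<dots> = (\<Sum>P\<in>insert Q Ps. \<Sum>R | R \<in> flats i \<and> R \<inter> S' = P. g R)"
      using S QL by (intro sum.cong[OF refl] sum.cong) (auto simp: Ps_def)
    also have "\<dots> = (\<Sum>R | R \<in> flats i \<and> R \<inter> S' = Q. g R)
        + (\<Sum>P\<in>Ps. \<Sum>R | R \<in> flats i \<and> R \<inter> S' = P. g R)"
      using finPs Qnot by simp
    also have "(\<Sum>P\<in>Ps. \<Sum>R | R \<in> flats i \<and> R \<inter> S' = P. g R)
        = (\<Sum>P\<in>Ps. mu d * (\<Sum>R | R \<in> Y \<and> P \<subseteq> R. g R))"
    proof (rule sum.cong[OF refl])
      fix P assume P: "P \<in> Ps"
      then have "(\<Sum>R | R \<in> flats i \<and> R \<inter> S' = P. g R)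
          = mu d * (\<Sum>R | R \<in> flats i \<and> P \<subseteq> R \<and> R \<subseteq> S'. g R)"
        using IH[of P S'] rkQ S'
        by (simp add: Ps_def flats_def)
      moreover have "{R. R \<in> flats i \<and> P \<subseteq> R \<and> R \<subseteq> S'} = {R. R \<in> Y \<and> P \<subseteq> R}"
        using P by (auto simp: Y_def Ps_def)
      ultimately show "(\<Sum>R | R \<in> flats i \<and> R \<inter> S' = P. g R) = mu d * (\<Sum>R | R \<in> Y \<and> P \<subseteq> R. g R)"
        by simp
    qed
    also have "\<dots> = mu d * (\<Sum>R\<in>Y. \<Sum>P | P \<in> Ps \<and> P \<subseteq> R. g R)"
      unfolding sum_distrib_left[symmetric]
      using sum.swap_restrict[OF finPs finY, of "\<lambda>P R. g R" "(\<subseteq>)"] by simp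
    \<comment> \<open>A flat inside \<open>S\<close> contains no member of \<open>Ps\<close>. Any
      other \<open>R\<close> meets \<open>S\<close> in a hyperplane of \<open>R\<close>, and exactly
      \<open>q ^ d\<close> covers of \<open>Q\<close> in \<open>R\<close> meet that hyperplane only
      in \<open>Q\<close>.\<close>
    also have "(\<Sum>R\<in>Y. \<Sum>P | P \<in> Ps \<and> P \<subseteq> R. g R)
        = (\<Sum>R\<in>Y. if R \<subseteq> S then 0 else real q ^ d * g R)"
    proof (rule sum.cong[OF refl])
      fix R assume R: "R \<in> Y"
      then have RL: "R \<in> L" "rk R = i" "Q \<subseteq> R" "R \<subseteq> S'" by (auto simp: Y_def flats_def)
      show "(\<Sum>P | P \<in> Ps \<and> P \<subseteq> R. g R) = (if R \<subseteq> S then 0 else real q ^ d * g R)"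
      proof (cases "R \<subseteq> S")
        case True
        then have "P = Q" if "P \<in> Ps" "P \<subseteq> R" for P
          using that by (auto simp: Ps_def)
        then have "{P. P \<in> Ps \<and> P \<subseteq> R} = {}" using Qnot by blast
        then show ?thesis using True by (metis sum.empty)
      next
        case False
        have IL: "R \<inter> S \<in> L" using Int_in RL S by blast
        have JL: "J R S \<in> L" "J R S \<subseteq> S'" "R \<subseteq> J R S" "S \<subseteq> J R S"
          using J_in[OF RL(1) S(1)] J_least[OF RL(1) S(1) S'(1) RL(4) S(4)]
            J_upper1[OF RL(1) S(1)] J_upper2[OF RL(1) S(1)] by auto
        have "rk S < rk (J R S)" using rk_strict_mono[of S "J R S"] JL S False by blast
        moreover have "rk (J R S) \<le> rk S'" using rk_mono JL S' by blast
        ultimately have "rk (J R S) = Suc (rk S)" using S S' by linarith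
        then have rkI: "rk (R \<inter> S) = rk Q + d" using modular[of R S] RL S rkQ by simp
        have "{P. P \<in> Ps \<and> P \<subseteq> R}
            = {P \<in> flats (Suc (rk Q)). Q \<subseteq> P \<and> P \<subseteq> R \<and> P \<inter> (R \<inter> S) = Q}"
          using RL S by (auto simp: Ps_def)
        then have "real (card {P. P \<in> Ps \<and> P \<subseteq> R}) = cnt (Suc (rk Q)) i d (rk Q)"
          using card_flats_between[of Q "R \<inter> S" R Q d "Suc (rk Q)"] QL IL RL S rkI by auto
        also have "\<dots> = (real (s (Suc (rk Q + d))) - real (s (rk Q + d)))
            / (real (s (Suc (rk Q))) - real (s (rk Q)))"
          using rkQ by (simp add: cnt_def del: s_Suc)
        also have "\<dots> = real q ^ d"
          using w_pos q_pos by (simp add: s_Suc power_add)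
        finally show ?thesis using False by simp
      qed
    qed
    also have "\<dots> = real q ^ d * (\<Sum>R\<in>Y - {R \<in> Y. R \<subseteq> S}. g R)"
      unfolding sum_distrib_left using finY by (intro sum.mono_neutral_cong_right) auto
    also have "\<dots> = real q ^ d * ((\<Sum>R\<in>Y. g R) - (\<Sum>R | R \<in> flats i \<and> Q \<subseteq> R \<and> R \<subseteq> S. g R))"
    proof -
      have "{R \<in> Y. R \<subseteq> S} = {R. R \<in> flats i \<and> Q \<subseteq> R \<and> R \<subseteq> S}" using S by (auto simp: Y_def)
      then show ?thesis using finY by (subst sum_diff) auto
    qed
    finally have "(\<Sum>R | R \<in> flats i \<and> R \<inter> S = Q. g R)
       = (\<Sum>R | R \<in> flats i \<and> R \<inter> S' = Q. g R)
        + mu d * (real q ^ d * ((\<Sum>R\<in>Y. g R) - (\<Sum>R | R \<in> flats i \<and> Q \<subseteq> R \<and> R \<subseteq> S. g R)))" .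
    \<comment> \<open>With this recursion, both sides of the claim change by the same amount from
      \<open>S\<close> to \<open>S'\<close>.\<close>
    moreover have "mu (Suc d) = - (mu d * real q ^ d)" by (simp add: mu_def)
    ultimately show ?case
      using Suc.IH[OF S(1,3,2)] by (simp add: Y_def algebra_simps)
  qed
  moreover obtain e where "rk S = rk Q + e"
    using rk_mono[of Q S] Suc.prems le_Suc_ex by blast
  ultimately show ?case using Suc.prems by blast
qed

text \<open>Induction on the rank: orthogonal projection writes \<open>f\<close> as the lift of a
  function \<open>h\<close> from rank \<open>k\<close> plus a residual, and orthogonality to the
  lifts makes the residual harmonic. The harmonic parts of \<open>h\<close> are kept up to a
  factor.\<close>

lemma harmonic_decomposition:
  "\<exists>g. (\<forall>i\<le>k. harmonic i (g i)) \<and>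
    (\<forall>S\<in>flats k. f S = (\<Sum>i\<le>k. \<Sum>R | R \<in> flats i \<and> R \<subseteq> S. g i R))"
proof (induction k arbitrary: f)
  case 0
  show ?case
    by (intro exI[of _ "\<lambda>_. f"]) (simp add: harmonic_def flats_below_self)
next
  case (Suc k)
  obtain h where h: "\<And>R. R \<in> flats k \<Longrightarrow>
      (\<Sum>S\<in>flats (Suc k). (f S - (\<Sum>R\<in>flats k. of_bool (R \<subseteq> S) * h R)) * of_bool (R \<subseteq> S)) = 0"
    using orthogonal_residual[of "flats (Suc k)" "flats k" f "\<lambda>S R. of_bool (R \<subseteq> S)"] by auto
  define g' where "g' S = f S - (\<Sum>R | R \<in> flats k \<and> R \<subseteq> S. h R)" for S
  have g'0: "(\<Sum>S | S \<in> flats (Suc k) \<and> R \<subseteq> S. g' S) = 0" if "R \<in> flats k" for R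
    using h[OF that] by (simp add: g'_def Int_def)
  have "harmonic (Suc k) g'"
    unfolding harmonic_def
  proof (intro ballI impI)
    fix Q assume Q: "Q \<in> L" "rk Q < Suc k"
    let ?X = "{R. R \<in> flats k \<and> Q \<subseteq> R}" and ?Y = "{S. S \<in> flats (Suc k) \<and> Q \<subseteq> S}"
    \<comment> \<open>The sums vanish for flats of rank \<open>k\<close>. For lower \<open>Q\<close>
      they are added over all \<open>R\<close> of rank \<open>k\<close> above \<open>Q\<close>,
      where each \<open>S\<close> is counted equally often.\<close>
    have "0 = (\<Sum>R\<in>?X. \<Sum>S | S \<in> flats (Suc k) \<and> R \<subseteq> S. g' S)"
      using g'0 by simp
    also have "\<dots> = (\<Sum>R\<in>?X. \<Sum>S | S \<in> ?Y \<and> R \<subseteq> S. g' S)"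
      by (intro sum.cong[OF refl] sum.cong) auto
    also have "\<dots> = (\<Sum>S\<in>?Y. \<Sum>R | R \<in> ?X \<and> R \<subseteq> S. g' S)"
      by (intro sum.swap_restrict) auto
    also have "\<dots> = (\<Sum>S\<in>?Y. cnt k (Suc k) 0 (rk Q) * g' S)"
    proof (rule sum.cong[OF refl])
      fix S assume S: "S \<in> ?Y"
      have "{R. R \<in> ?X \<and> R \<subseteq> S} = {R \<in> flats k. Q \<subseteq> R \<and> R \<subseteq> S}" by auto
      then have "real (card {R. R \<in> ?X \<and> R \<subseteq> S}) = cnt k (Suc k) 0 (rk Q)"
        using card_flats_interval[of Q S k] S Q by (simp add: flats_def)
      then show "(\<Sum>R | R \<in> ?X \<and> R \<subseteq> S. g' S) = cnt k (Suc k) 0 (rk Q) * g' S"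
        by simp
    qed
    finally show "(\<Sum>S\<in>?Y. g' S) = 0"
      using cnt_pos[of k 0 "Suc k" "rk Q"] by (simp add: sum_distrib_left[symmetric])
  qed
  moreover obtain g where g: "\<And>i. i \<le> k \<Longrightarrow> harmonic i (g i)"
    "\<And>R. R \<in> flats k \<Longrightarrow> h R = (\<Sum>i\<le>k. \<Sum>P | P \<in> flats i \<and> P \<subseteq> R. g i P)"
    using Suc.IH[of h] by blast
  \<comment> \<open>Lifting from rank \<open>i\<close> to rank \<open>k\<close> and then to
    \<open>Suc k\<close> counts each \<open>P\<close> below \<open>S\<close> once for every flat of
    rank \<open>k\<close> in between; the factor is their number.\<close>
  define G where "G i = (if i = Suc k then g' else (\<lambda>P. cnt k (Suc k) 0 i * g i P))" for i
  have "harmonic i (G i)" if "i \<le> k" for i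
    using g(1)[OF that] that by (auto simp: G_def harmonic_def sum_distrib_left[symmetric])
  moreover have "f S = (\<Sum>i\<le>Suc k. \<Sum>R | R \<in> flats i \<and> R \<subseteq> S. G i R)"
    if S: "S \<in> flats (Suc k)" for S
  proof -
    let ?X = "{R. R \<in> flats k \<and> R \<subseteq> S}"
    have "(\<Sum>R\<in>?X. h R) = (\<Sum>R\<in>?X. \<Sum>i\<le>k. \<Sum>P | P \<in> flats i \<and> P \<subseteq> R. g i P)"
      using g(2) by simp
    also have "\<dots> = (\<Sum>i\<le>k. \<Sum>R\<in>?X. \<Sum>P | P \<in> flats i \<and> P \<subseteq> R. g i P)"
      by (rule sum.swap)
    also have "\<dots> = (\<Sum>i\<le>k. \<Sum>P | P \<in> flats i \<and> P \<subseteq> S. G i P)"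
    proof (rule sum.cong[OF refl])
      fix i assume i: "i \<in> {..k}"
      let ?Y = "{P. P \<in> flats i \<and> P \<subseteq> S}"
      have "(\<Sum>R\<in>?X. \<Sum>P | P \<in> flats i \<and> P \<subseteq> R. g i P) = (\<Sum>R\<in>?X. \<Sum>P | P \<in> ?Y \<and> P \<subseteq> R. g i P)"
        by (intro sum.cong[OF refl] sum.cong) auto
      also have "\<dots> = (\<Sum>P\<in>?Y. \<Sum>R | R \<in> ?X \<and> P \<subseteq> R. g i P)"
        by (intro sum.swap_restrict) auto
      also have "\<dots> = (\<Sum>P\<in>?Y. G i P)"
      proof (rule sum.cong[OF refl])
        fix P assume P: "P \<in> ?Y"
        have "{R. R \<in> ?X \<and> P \<subseteq> R} = {R \<in> flats k. P \<subseteq> R \<and> R \<subseteq> S}" by auto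
        then have "real (card {R. R \<in> ?X \<and> P \<subseteq> R}) = cnt k (Suc k) 0 i"
          using card_flats_interval[of P S k] S P i by (simp add: flats_def)
        then show "(\<Sum>R | R \<in> ?X \<and> P \<subseteq> R. g i P) = G i P"
          using i by (simp add: G_def)
      qed
      finally show "(\<Sum>R\<in>?X. \<Sum>P | P \<in> flats i \<and> P \<subseteq> R. g i P) = (\<Sum>P\<in>?Y. G i P)" .
    qed
    finally have "f S = g' S + (\<Sum>i\<le>k. \<Sum>P | P \<in> flats i \<and> P \<subseteq> S. G i P)"
      by (simp add: g'_def)
    moreover have "{P. P \<in> flats (Suc k) \<and> P \<subseteq> S} = {S}"
      by (rule flats_below_self[OF S])
    ultimately show ?thesis by (simp add: G_def)
  qed
  moreover have "G (Suc k) = g'" by (simp add: G_def)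
  ultimately show ?case by (intro exI[of _ G]) (auto simp: le_Suc_eq)
qed

subsection \<open>The least eigenvalue of the disjointness graph\<close>

text \<open>The eigenvalue of the disjointness graph that belongs to harmonic functions of degree \<open>i\<close>.\<close>

definition lam :: "nat \<Rightarrow> nat \<Rightarrow> real" where
  "lam r i = cnt r (rk E) r i * mu i"

text \<open>The vector chromatic number of the disjointness graph.\<close>

definition opt :: "nat \<Rightarrow> real" where
  "opt r = (real (s (rk E)) - real (s 0)) / (real (s r) - real (s 0))"

lemma s_diff: "real (s (i + k)) - real (s i) = real w * real q ^ i * (\<Sum>l<k. real q ^ l)"
  by (induction k) (simp_all add: s_Suc algebra_simps power_add)

text \<open>By \<open>s_diff\<close>, starting at \<open>j\<close> instead of \<open>i\<close>
  multiplies the increment of \<open>s\<close> over \<open>k\<close> ranks by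
  \<open>q ^ (j - i)\<close>.\<close>

lemma s_growth:
  assumes "i \<le> j" "k \<le> l"
  shows "real q ^ (j - i) * (real (s (i + k)) - real (s i)) \<le> real (s (j + l)) - real (s j)"
proof -
  have "(\<Sum>h<k. real q ^ h) \<le> (\<Sum>h<l. real q ^ h)"
    using assms by (intro sum_mono2) auto
  then have "real w * real q ^ j * (\<Sum>h<k. real q ^ h) \<le> real w * real q ^ j * (\<Sum>h<l. real q ^ h)"
    by (intro mult_left_mono) auto
  moreover have "real q ^ j = real q ^ (j - i) * real q ^ i"
    using assms by (simp flip: power_add)
  then have "real q ^ (j - i) * (real w * real q ^ i * (\<Sum>h<k. real q ^ h))
      = real w * real q ^ j * (\<Sum>h<k. real q ^ h)"
    by (simp only: mult_ac)
  ultimately show ?thesis by (simp only: s_diff)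
qed

text \<open>The ratio of the two absolute values is
  \<open>q ^ i * (s r - s i) / (s n - s (i + r))\<close> with \<open>n = rk E\<close>. The numerator
  is at most \<open>s (2 * r) - s (i + r)\<close>, and \<open>2 * r < n\<close> makes the inequality
  strict.\<close>

lemma abs_lam_less:
  assumes "i < r" "2 * r + 1 \<le> rk E"
  shows "\<bar>lam r (Suc i)\<bar> < \<bar>lam r i\<bar>"
proof -
  let ?n = "rk E"
  have pos: "0 < cnt r ?n r i" "0 < cnt r ?n r (Suc i)" using assms by (auto intro!: cnt_pos)
  have "real q ^ i * (real (s r) - real (s i)) \<le> real q ^ r * (real (s r) - real (s i))"
    using assms q_pos by (intro mult_right_mono power_increasing) auto
  also have "\<dots> \<le> real (s (i + r + (r - i))) - real (s (i + r))"
    using s_growth[of i "i + r" "r - i" "r - i"] assms by simp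
  also have "\<dots> < real (s ?n) - real (s (i + r))"
    using assms by simp
  finally have less: "real q ^ i * (real (s r) - real (s i)) < real (s ?n) - real (s (i + r))" .
  have "\<bar>mu (Suc i)\<bar> = \<bar>mu i\<bar> * real q ^ i"
    by (simp add: mu_def abs_mult)
  moreover have mu: "0 < \<bar>mu i\<bar>"
    using q_pos by (simp add: mu_def)
  ultimately have "\<bar>lam r (Suc i)\<bar> * (real (s r) - real (s i))
      = cnt r ?n r (Suc i) * \<bar>mu i\<bar> * (real q ^ i * (real (s r) - real (s i)))"
    using pos by (simp add: lam_def abs_mult)
  also have "\<dots> < cnt r ?n r (Suc i) * \<bar>mu i\<bar> * (real (s ?n) - real (s (i + r)))"
    using less pos mu by (intro mult_strict_left_mono) auto
  also have "\<dots> = \<bar>lam r i\<bar> * (real (s r) - real (s i))"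
    using cnt_rec[of i r ?n r] assms pos by (simp add: lam_def abs_mult mult_ac)
  finally show ?thesis
    using assms by (simp add: mult_less_cancel_right)
qed

lemma abs_lam_antimono:
  assumes "i < j" "j \<le> r" "2 * r + 1 \<le> rk E"
  shows "\<bar>lam r j\<bar> < \<bar>lam r i\<bar>"
  using assms
proof (induction j)
  case (Suc j)
  have "\<bar>lam r (Suc j)\<bar> < \<bar>lam r j\<bar>" using abs_lam_less[of j r] Suc.prems by simp
  moreover have "\<bar>lam r j\<bar> \<le> \<bar>lam r i\<bar>"
    using Suc by (cases "i = j") auto
  ultimately show ?case by linarith
qed simp

lemma lam_1: "lam r 1 = - cnt r (rk E) r 1"
  by (simp add: lam_def mu_def)

text \<open>For \<open>i \<ge> 2\<close> the absolute value is smaller than that of the negative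
  \<open>lam r 1\<close>, while \<open>lam r 0\<close> is the valency and positive.\<close>

lemma lam_least:
  assumes "i \<noteq> 1" "i \<le> r" "2 * r + 1 \<le> rk E"
  shows "lam r 1 < lam r i"
proof (cases "i = 0")
  case True
  have "0 < cnt r (rk E) r 0" "0 < cnt r (rk E) r 1"
    using assms by (auto intro!: cnt_pos)
  then show ?thesis using True lam_1 by (simp add: lam_def mu_def)
next
  case False
  then have "\<bar>lam r i\<bar> < \<bar>lam r 1\<bar>" using abs_lam_antimono[of 1 i r] assms by simp
  moreover have "lam r 1 < 0" using lam_1 cnt_pos[of r r "rk E" 1] assms by simp
  ultimately show ?thesis by linarith
qed

text \<open>After the sums are exchanged, every \<open>R\<close> that meets \<open>S\<close> in
  \<open>B\<close> lies in \<open>cnt r (rk E) r i\<close> neighbours of \<open>S\<close>, and every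
  other \<open>R\<close> in none. Then \<open>harmonic_disjoint\<close> at \<open>Q = B\<close>
  replaces the sum over these \<open>R\<close> by the sum over those inside
  \<open>S\<close>.\<close>

lemma adjacency_harmonic:
  assumes "harmonic i g" "i \<le> r" "S \<in> flats r"
  shows "(\<Sum>T\<in>flats r. of_bool (S \<inter> T = B) * (\<Sum>R | R \<in> flats i \<and> R \<subseteq> T. g R))
    = lam r i * (\<Sum>R | R \<in> flats i \<and> R \<subseteq> S. g R)"
proof -
  let ?X = "{T \<in> flats r. S \<inter> T = B}" and ?Y = "{R. R \<in> flats i \<and> R \<inter> S = B}"
  have S: "S \<in> L" "rk S = r" using assms by (auto simp: flats_def)
  have "(\<Sum>T\<in>flats r. of_bool (S \<inter> T = B) * (\<Sum>R | R \<in> flats i \<and> R \<subseteq> T. g R))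
      = (\<Sum>T\<in>?X. \<Sum>R | R \<in> flats i \<and> R \<subseteq> T. g R)"
    by (intro sum.mono_neutral_cong_right) auto
  also have "\<dots> = (\<Sum>T\<in>?X. \<Sum>R | R \<in> ?Y \<and> R \<subseteq> T. g R)"
  proof (intro sum.cong refl set_eqI)
    fix T R assume T: "T \<in> ?X"
    have "R \<inter> S = B" if "R \<in> flats i" "R \<subseteq> T"
      using B_le[of R] B_le[OF S(1)] T that by (auto simp: flats_def)
    then show "R \<in> {R. R \<in> flats i \<and> R \<subseteq> T} \<longleftrightarrow> R \<in> {R. R \<in> ?Y \<and> R \<subseteq> T}" by auto
  qed
  also have "\<dots> = (\<Sum>R\<in>?Y. \<Sum>T | T \<in> ?X \<and> R \<subseteq> T. g R)"
    by (intro sum.swap_restrict) auto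
  also have "\<dots> = (\<Sum>R\<in>?Y. cnt r (rk E) r i * g R)"
  proof (rule sum.cong[OF refl])
    fix R assume R: "R \<in> ?Y"
    then have RL: "R \<in> L" "rk R = i" "R \<inter> S = B" by (auto simp: flats_def)
    have "{T. T \<in> ?X \<and> R \<subseteq> T} = {T \<in> flats r. R \<subseteq> T \<and> T \<subseteq> E \<and> T \<inter> S = B}"
      using le_E by (auto simp: flats_def)
    then have "real (card {T. T \<in> ?X \<and> R \<subseteq> T}) = cnt r (rk E) r i"
      using card_flats_between[OF RL(1) S(1) E_in le_E[OF RL(1)] le_E[OF S(1)] RL(3), of r r]
        RL S rk_B assms by simp
    then show "(\<Sum>T | T \<in> ?X \<and> R \<subseteq> T. g R) = cnt r (rk E) r i * g R" by simp
  qed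
  also have "\<dots> = cnt r (rk E) r i * (mu i * (\<Sum>R | R \<in> flats i \<and> B \<subseteq> R \<and> R \<subseteq> S. g R))"
    using harmonic_disjoint[OF assms(1) B_in S(1) B_le[OF S(1)], of i] rk_B
    by (simp add: sum_distrib_left[symmetric])
  also have "{R. R \<in> flats i \<and> B \<subseteq> R \<and> R \<subseteq> S} = {R. R \<in> flats i \<and> R \<subseteq> S}"
    using B_le by (auto simp: flats_def)
  finally show ?thesis by (simp add: lam_def)
qed

definition form :: "nat \<Rightarrow> ('a set \<Rightarrow> real) \<Rightarrow> real" where
  "form r f = (\<Sum>S\<in>flats r. \<Sum>T\<in>flats r. of_bool (S \<inter> T = B) * (f S * f T))"

text \<open>The eigenvalues of the harmonic parts are distinct because their absolute values are.
  The bound serves for each coordinate of a coloring separately.\<close>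

lemma form_bound:
  fixes f :: "'a set \<Rightarrow> real"
  assumes "0 < r" "2 * r + 1 \<le> rk E"
  shows "lam r 1 * (\<Sum>S\<in>flats r. f S * f S) \<le> form r f"
    and "form r f = lam r 1 * (\<Sum>S\<in>flats r. f S * f S) \<Longrightarrow> \<exists>g. harmonic 1 g \<and> (\<forall>S\<in>flats r. f S = (\<Sum>R | R \<in> flats 1 \<and> R \<subseteq> S. g R))"
proof -
  obtain g where g: "\<And>i. i \<le> r \<Longrightarrow> harmonic i (g i)"
    "\<And>S. S \<in> flats r \<Longrightarrow> f S = (\<Sum>i\<le>r. \<Sum>R | R \<in> flats i \<and> R \<subseteq> S. g i R)"
    using harmonic_decomposition[of r f] by blast
  define F where "F i S = (\<Sum>R | R \<in> flats i \<and> R \<subseteq> S. g i R)" for i S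
  have inj: "inj_on (lam r) {..r}"
  proof (rule inj_onI)
    fix i j assume "i \<in> {..r}" "j \<in> {..r}" "lam r i = lam r j"
    then show "i = j"
      using abs_lam_antimono[of i j r] abs_lam_antimono[of j i r] assms by (cases i j rule: linorder_cases) auto
  qed
  have ev: "(\<Sum>T\<in>flats r. of_bool (S \<inter> T = B) * F i T) = lam r i * F i S"
    if "i \<in> {..r}" "S \<in> flats r" for i S
    using adjacency_harmonic[of i "g i" r S] g that by (simp add: F_def)
  have sym: "of_bool (S \<inter> T = B) = (of_bool (T \<inter> S = B) :: real)" for S T
    by (simp add: Int_commute)
  note bound = sum_of_eigenvectors_bound[where a = "\<lambda>S T. of_bool (S \<inter> T = B)" and F = F
      and lam = "lam r" and V = "flats r" and I = "{..r}" and m = 1 and f = f,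
      OF finite_flats finite_atMost sym ev inj]
  have fF: "f S = (\<Sum>i\<in>{..r}. F i S)" if "S \<in> flats r" for S
    using g(2)[OF that] by (simp add: F_def)
  show "lam r 1 * (\<Sum>S\<in>flats r. f S * f S) \<le> form r f"
    unfolding form_def using bound(1)[OF _ _ fF] lam_least assms by auto
  assume "form r f = lam r 1 * (\<Sum>S\<in>flats r. f S * f S)"
  then have "f S = F 1 S" if "S \<in> flats r" for S
    using bound(2)[OF _ _ fF] lam_least assms that by (auto simp: form_def)
  then show "\<exists>g. harmonic 1 g \<and> (\<forall>S\<in>flats r. f S = (\<Sum>R | R \<in> flats 1 \<and> R \<subseteq> S. g R))"
    using g(1)[of 1] assms by (intro exI[of _ "g 1"]) (simp add: F_def)
qed

section \<open>Points and hyperplanes of a flat\<close>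

lemma card_points: "U \<in> L \<Longrightarrow> real (card {P. P \<in> flats 1 \<and> P \<subseteq> U}) = cnt 1 (rk U) 0 0"
proof -
  assume U: "U \<in> L"
  have "{P. P \<in> flats 1 \<and> P \<subseteq> U} = {P \<in> flats 1. B \<subseteq> P \<and> P \<subseteq> U}"
    using B_le by (auto simp: flats_def)
  then show ?thesis using card_flats_interval[OF B_in U B_le[OF U], of 1] rk_B by simp
qed

text \<open>All hyperplanes of a flat \<open>Z\<close> of rank \<open>r + 1\<close> through
  \<open>P\<close> with \<open>Z \<inter> W = B\<close> have the same sum of \<open>\<phi>\<close>.
  The point-hyperplane incidence matrix of \<open>Z\<close> is invertible, so \<open>\<phi>\<close>
  is constant on the points of \<open>Z\<close>; \<open>cnt 1 r 0 0\<close> is the number of points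
  of a hyperplane.\<close>

lemma hyperplane_sums_determine:
  fixes \<phi> :: "'a set \<Rightarrow> real"
  assumes r: "0 < r" and W: "W \<in> L" "rk W + r + 1 \<le> rk E"
    and sums: "\<And>U. U \<in> flats r \<Longrightarrow> U \<inter> W = B \<Longrightarrow> (\<Sum>P | P \<in> flats 1 \<and> P \<subseteq> U. \<phi> P) = C"
    and P: "P \<in> flats 1" "P \<inter> W = B"
  shows "\<phi> P = C / cnt 1 r 0 0"
proof -
  define \<psi> where "\<psi> Q = \<phi> Q - C / cnt 1 r 0 0" for Q
  have PL: "P \<in> L" "rk P = 1" using P by (auto simp: flats_def)
  obtain Z where Z: "Z \<in> L" "rk Z = r + 1" "P \<subseteq> Z" "Z \<inter> W = B"
    by (rule flat_between_exists[OF PL(1) W(1) E_in le_E[OF PL(1)] le_E[OF W(1)] P(2),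
          where a = "rk W" and k = "r + 1"]) (use rk_B PL W r in \<open>auto intro: that\<close>)
  let ?Y = "{Q. Q \<in> flats 1 \<and> Q \<subseteq> Z}"
  have zero: "(\<Sum>Q | Q \<in> ?Y \<and> Q \<subseteq> U. \<psi> Q) = 0" if "U \<in> flats r" "U \<subseteq> Z" for U
  proof -
    have UL: "U \<in> L" "rk U = r" using that by (auto simp: flats_def)
    have "U \<inter> W = B" using Z that B_le[OF UL(1)] B_le[OF W(1)] by blast
    then have "(\<Sum>Q | Q \<in> flats 1 \<and> Q \<subseteq> U. \<phi> Q) = C" using sums that by blast
    moreover have "{Q. Q \<in> ?Y \<and> Q \<subseteq> U} = {Q. Q \<in> flats 1 \<and> Q \<subseteq> U}" using that by auto
    moreover have "0 < cnt 1 r 0 0" using r by (intro cnt_pos) simp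
    ultimately show ?thesis
      using card_points[OF UL(1)] UL by (simp add: \<psi>_def sum_subtractf)
  qed
  \<comment> \<open>The numbers of hyperplanes of \<open>Z\<close> through one point and through two
    distinct points. For \<open>r = 1\<close> the hyperplanes are points and the second number is 0,
    whereas \<open>cnt r (r + 1) 0 2\<close> would be an empty product.\<close>
  define h1 where "h1 = cnt r (r + 1) 0 1"
  define h2 where "h2 = (if r = 1 then 0 else cnt r (r + 1) 0 2)"
  have h1: "0 < h1" unfolding h1_def by (intro cnt_pos) simp
  have h12: "h1 \<noteq> h2"
  proof (cases "r = 1")
    case True then show ?thesis using h1 by (simp add: h2_def)
  next
    case False
    then have "h1 * (real (s r) - real (s 1)) = (real (s (r + 1)) - real (s 1)) * h2"
      using cnt_rec[of 1 r "r + 1" 0] r by (simp add: h1_def h2_def numeral_2_eq_2)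
    moreover have "real (s r) - real (s 1) \<noteq> real (s (r + 1)) - real (s 1)" by simp
    ultimately show ?thesis using h1 by auto
  qed
  have through: "real (card {U \<in> flats r. P' \<subseteq> U \<and> U \<subseteq> Z}) = h1" if "P' \<in> ?Y" for P'
    using card_flats_interval[of P' Z r] that Z r by (simp add: flats_def h1_def)
  \<comment> \<open>This cancels the \<open>h2\<close> part of the sum over the hyperplanes through
    \<open>P\<close> below.\<close>
  have total: "(\<Sum>Q\<in>?Y. \<psi> Q) = 0"
  proof -
    let ?X = "{U. U \<in> flats r \<and> U \<subseteq> Z}"
    have "0 = (\<Sum>U\<in>?X. \<Sum>Q | Q \<in> ?Y \<and> Q \<subseteq> U. \<psi> Q)" using zero by simp
    also have "\<dots> = (\<Sum>Q\<in>?Y. \<Sum>U | U \<in> ?X \<and> Q \<subseteq> U. \<psi> Q)"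
      by (intro sum.swap_restrict) auto
    also have "\<dots> = (\<Sum>Q\<in>?Y. h1 * \<psi> Q)"
    proof (rule sum.cong[OF refl])
      fix Q assume Q: "Q \<in> ?Y"
      have "{U. U \<in> ?X \<and> Q \<subseteq> U} = {U \<in> flats r. Q \<subseteq> U \<and> U \<subseteq> Z}" by auto
      then show "(\<Sum>U | U \<in> ?X \<and> Q \<subseteq> U. \<psi> Q) = h1 * \<psi> Q" using through[OF Q] by simp
    qed
    finally show ?thesis using h1 by (simp add: sum_distrib_left[symmetric])
  qed
  let ?X = "{U. U \<in> flats r \<and> P \<subseteq> U \<and> U \<subseteq> Z}"
  have PY: "P \<in> ?Y" using P Z by simp
  have "0 = (\<Sum>U\<in>?X. \<Sum>Q | Q \<in> ?Y \<and> Q \<subseteq> U. \<psi> Q)" using zero by simp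
  also have "\<dots> = (\<Sum>Q\<in>?Y. \<Sum>U | U \<in> ?X \<and> Q \<subseteq> U. \<psi> Q)"
    by (intro sum.swap_restrict) auto
  also have "\<dots> = (\<Sum>Q\<in>?Y. h2 * \<psi> Q + (if Q = P then (h1 - h2) * \<psi> P else 0))"
  proof (rule sum.cong[OF refl])
    fix Q assume Q: "Q \<in> ?Y"
    have "real (card {U. U \<in> ?X \<and> Q \<subseteq> U}) = (if Q = P then h1 else h2)"
    proof (cases "Q = P")
      case True
      have "{U. U \<in> ?X \<and> P \<subseteq> U} = {U \<in> flats r. P \<subseteq> U \<and> U \<subseteq> Z}" by auto
      then show ?thesis using through[OF PY] True by simp
    next
      case False
      have QL: "Q \<in> L" "rk Q = 1" using Q by (auto simp: flats_def)
      have "P \<inter> Q = B" using points_Int[OF P(1)] Q False by blast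
      then have J2: "rk (J P Q) = 2" using modular[OF PL(1) QL(1)] PL QL rk_B by simp
      have JL: "J P Q \<in> L" using J_in PL QL by blast
      have JZ: "J P Q \<subseteq> Z" using J_least[OF PL(1) QL(1) Z(1,3)] Q by blast
      have "J P Q \<subseteq> U \<longleftrightarrow> P \<subseteq> U \<and> Q \<subseteq> U" if "U \<in> L" for U
        using J_least[OF PL(1) QL(1) that] J_upper1[OF PL(1) QL(1)] J_upper2[OF PL(1) QL(1)] by blast
      then have eq: "{U. U \<in> ?X \<and> Q \<subseteq> U} = {U \<in> flats r. J P Q \<subseteq> U \<and> U \<subseteq> Z}"
        by (auto simp: flats_def)
      show ?thesis
      proof (cases "r = 1")
        case True
        then have "\<not> J P Q \<subseteq> U" if "U \<in> flats r" for U
          using rk_mono[OF JL, of U] J2 that by (auto simp: flats_def)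
        then have "{U \<in> flats r. J P Q \<subseteq> U \<and> U \<subseteq> Z} = {}" by blast
        then show ?thesis using eq True False by (simp add: h2_def)
      next
        case r1: False
        then show ?thesis
          using card_flats_interval[OF JL Z(1) JZ, of r] eq False J2 Z r by (simp add: h2_def)
      qed
    qed
    then show "(\<Sum>U | U \<in> ?X \<and> Q \<subseteq> U. \<psi> Q) = h2 * \<psi> Q + (if Q = P then (h1 - h2) * \<psi> P else 0)"
      by (simp add: algebra_simps)
  qed
  also have "\<dots> = (h1 - h2) * \<psi> P"
    using total PY by (simp add: sum.distrib sum_distrib_left[symmetric])
  finally show ?thesis using h12 by (simp add: \<psi>_def)
qed

subsection \<open>Vector colorings\<close>

lemma card_disjoint_flats:
  assumes "S \<in> flats r"
  shows "real (card {T \<in> flats r. S \<inter> T = B}) = cnt r (rk E) r 0"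
proof -
  have S: "S \<in> L" "rk S = r" using assms by (auto simp: flats_def)
  have "{T \<in> flats r. S \<inter> T = B} = {T \<in> flats r. B \<subseteq> T \<and> T \<subseteq> E \<and> T \<inter> S = B}"
    using B_le le_E by (auto simp: flats_def)
  moreover have "B \<inter> S = B" using B_le[OF S(1)] by blast
  ultimately show ?thesis
    using card_flats_between[OF B_in S(1) E_in le_E[OF B_in] le_E[OF S(1)], of B r r] S rk_B by simp
qed

text \<open>Here \<open>cnt r (rk E) r 0\<close> is the valency and
  \<open>- cnt r (rk E) r 1\<close> the least eigenvalue, so \<open>opt r\<close> is the ratio
  bound, one minus valency over least eigenvalue.\<close>

lemma opt_minus_1:
  assumes "0 < r" "2 * r + 1 \<le> rk E"
  shows "opt r - 1 = cnt r (rk E) r 0 / cnt r (rk E) r 1"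
    and "opt r - 1 = (real (s (rk E)) - real (s r)) / (real (s r) - real (s 0))"
proof -
  have pos: "0 < cnt r (rk E) r 1" using assms by (intro cnt_pos) simp
  have d: "0 < real (s r) - real (s 0)" using assms by simp
  show *: "opt r - 1 = (real (s (rk E)) - real (s r)) / (real (s r) - real (s 0))"
    using d by (simp add: opt_def field_simps)
  have "cnt r (rk E) r 0 * (real (s r) - real (s 0)) = (real (s (rk E)) - real (s r)) * cnt r (rk E) r 1"
    using cnt_rec[of 0 r "rk E" r] assms by simp
  then show "opt r - 1 = cnt r (rk E) r 0 / cnt r (rk E) r 1"
    using pos d unfolding * by (simp add: field_simps)
qed

lemma two_le_opt:
  assumes "0 < r" "2 * r + 1 \<le> rk E"
  shows "2 \<le> opt r"
proof -
  have "real (s r) - real (s 0) \<le> real q ^ r * (real (s r) - real (s 0))"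
    using q_pos by (simp add: mult_le_cancel_right1)
  also have "\<dots> \<le> real (s (r + r)) - real (s r)"
    using s_growth[of 0 r r r] by simp
  also have "\<dots> \<le> real (s (rk E)) - real (s r)"
    using assms by simp
  finally have "1 \<le> opt r - 1"
    using assms by (simp add: opt_minus_1(2)[OF assms])
  then show ?thesis by simp
qed

text \<open>The sum of the inner products over ordered edges is at most
  \<open>- (N * ?k0 / (t - 1))\<close> by the edge condition, and at least
  \<open>- (N * ?k1)\<close> by the least eigenvalue in each coordinate. At \<open>t = opt r\<close>
  the bounds agree, which forces equality on every edge and puts every coordinate into the least
  eigenspace.\<close>

lemma coloring_bound:
  assumes r: "0 < r" "2 * r + 1 \<le> rk E" and t: "1 < t"
    and unit: "\<And>S. S \<in> flats r \<Longrightarrow> dot d (p S) (p S) = 1"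
    and edge: "\<And>S T. S \<in> flats r \<Longrightarrow> T \<in> flats r \<Longrightarrow> S \<inter> T = B \<Longrightarrow> dot d (p S) (p T) \<le> - 1 / (t - 1)"
  shows "opt r \<le> t"
    and "t = opt r \<Longrightarrow> S \<in> flats r \<Longrightarrow> T \<in> flats r \<Longrightarrow> S \<inter> T = B \<Longrightarrow>
      dot d (p S) (p T) = - 1 / (opt r - 1)"
    and "t = opt r \<Longrightarrow> l < d \<Longrightarrow>
      \<exists>g. harmonic 1 g \<and> (\<forall>S\<in>flats r. p S l = (\<Sum>R | R \<in> flats 1 \<and> R \<subseteq> S. g R))"
proof -
  let ?V = "flats r" and ?k0 = "cnt r (rk E) r 0" and ?k1 = "cnt r (rk E) r 1"
  define N where "N = real (card ?V)"
  define total where "total = (\<Sum>S\<in>?V. \<Sum>T\<in>?V. of_bool (S \<inter> T = B) * dot d (p S) (p T))"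
  have k: "0 < ?k0" "0 < ?k1" using r by (auto intro!: cnt_pos)
  have "flats r \<noteq> {}"
    using flat_between_exists[OF B_in B_in E_in le_E[OF B_in] le_E[OF B_in] Int_absorb, of 0 r] rk_B r
    by (force simp: flats_def)
  then have N: "0 < N" by (simp add: N_def card_gt_0_iff)
  have sum_edges: "(\<Sum>S\<in>?V. \<Sum>T\<in>?V. of_bool (S \<inter> T = B) * c) = N * ?k0 * c" for c
  proof -
    have "(\<Sum>T\<in>?V. of_bool (S \<inter> T = B) * c) = ?k0 * c" if "S \<in> ?V" for S
      using card_disjoint_flats[OF that] by (simp add: Int_def)
    then have "(\<Sum>S\<in>?V. \<Sum>T\<in>?V. of_bool (S \<inter> T = B) * c) = (\<Sum>S\<in>?V. ?k0 * c)"
      by (rule sum.cong[OF refl])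
    then show ?thesis by (simp add: N_def)
  qed
  have nn: "0 \<le> of_bool (S \<inter> T = B) * (- 1 / (t - 1) - dot d (p S) (p T))"
    if "S \<in> ?V" "T \<in> ?V" for S T
    using edge[OF that] by simp
  have slack: "(\<Sum>S\<in>?V. \<Sum>T\<in>?V. of_bool (S \<inter> T = B) * (- 1 / (t - 1) - dot d (p S) (p T)))
      = - (N * ?k0 / (t - 1)) - total"
    using sum_edges[of "- 1 / (t - 1)"] by (simp add: total_def right_diff_distrib sum_subtractf)
  have upper: "total \<le> - (N * ?k0 / (t - 1))"
  proof -
    have "0 \<le> (\<Sum>S\<in>?V. \<Sum>T\<in>?V. of_bool (S \<inter> T = B) * (- 1 / (t - 1) - dot d (p S) (p T)))"
      by (intro sum_nonneg nn)
    then show ?thesis using slack by simp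
  qed
  have norm: "(\<Sum>l<d. \<Sum>S\<in>?V. p S l * p S l) = N"
    using unit by (subst sum.swap) (simp add: dot_def N_def)
  have total_form: "total = (\<Sum>l<d. form r (\<lambda>S. p S l))"
  proof -
    have "total = (\<Sum>S\<in>?V. \<Sum>T\<in>?V. \<Sum>l<d. of_bool (S \<inter> T = B) * (p S l * p T l))"
      by (simp add: total_def dot_def sum_distrib_left)
    also have "\<dots> = (\<Sum>S\<in>?V. \<Sum>l<d. \<Sum>T\<in>?V. of_bool (S \<inter> T = B) * (p S l * p T l))"
      by (intro sum.cong refl sum.swap)
    also have "\<dots> = (\<Sum>l<d. form r (\<lambda>S. p S l))"
      unfolding form_def by (rule sum.swap)
    finally show ?thesis .
  qed
  have excess_nn: "0 \<le> form r (\<lambda>S. p S l) - lam r 1 * (\<Sum>S\<in>?V. p S l * p S l)" for l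
    using form_bound(1)[OF r] by simp
  have excess: "(\<Sum>l<d. form r (\<lambda>S. p S l) - lam r 1 * (\<Sum>S\<in>?V. p S l * p S l)) = total + N * ?k1"
    by (simp add: total_form sum.distrib sum_distrib_left[symmetric] norm lam_1 del: One_nat_def)
  have lower: "- (N * ?k1) \<le> total"
  proof -
    have "0 \<le> (\<Sum>l<d. form r (\<lambda>S. p S l) - lam r 1 * (\<Sum>S\<in>?V. p S l * p S l))"
      by (intro sum_nonneg excess_nn)
    then show ?thesis unfolding excess by simp
  qed
  have "N * (?k0 / (t - 1)) \<le> N * ?k1" using upper lower by simp
  then have "?k0 / (t - 1) \<le> ?k1" using N by (rule mult_left_le_imp_le)
  then have "?k0 / ?k1 \<le> t - 1" using k t by (simp add: field_simps)
  then show "opt r \<le> t" using opt_minus_1(1)[OF r] by simp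
  assume "t = opt r"
  then have t1: "t - 1 = ?k0 / ?k1" using opt_minus_1(1)[OF r] by simp
  then have "N * ?k0 / (t - 1) = N * ?k1" using k by simp
  then have total: "total = - (N * ?k1)" using upper lower by simp
  { assume S: "S \<in> ?V" and T: "T \<in> ?V" and ST: "S \<inter> T = B"
    have "(\<Sum>S\<in>?V. \<Sum>T\<in>?V. of_bool (S \<inter> T = B) * (- 1 / (t - 1) - dot d (p S) (p T))) = 0"
      using slack total \<open>N * ?k0 / (t - 1) = N * ?k1\<close> by simp
    then have "(\<Sum>T\<in>?V. of_bool (S \<inter> T = B) * (- 1 / (t - 1) - dot d (p S) (p T))) = 0"
      by (rule sum_nonneg_0[OF finite_flats sum_nonneg, rotated -2]) (use nn S in auto)
    then have "of_bool (S \<inter> T = B) * (- 1 / (t - 1) - dot d (p S) (p T)) = 0"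
      by (rule sum_nonneg_0[OF finite_flats nn[OF S] _ T, rotated -1])
    then show "dot d (p S) (p T) = - 1 / (opt r - 1)" using ST \<open>t = opt r\<close> by simp }
  { assume l: "l < d"
    have "form r (\<lambda>S. p S l) - lam r 1 * (\<Sum>S\<in>?V. p S l * p S l) = 0"
      using excess total excess_nn l
        sum_nonneg_eq_0_iff[of "{..<d}" "\<lambda>l. form r (\<lambda>S. p S l) - lam r 1 * (\<Sum>S\<in>?V. p S l * p S l)"]
      by simp
    then show "\<exists>g. harmonic 1 g \<and> (\<forall>S\<in>?V. p S l = (\<Sum>R | R \<in> flats 1 \<and> R \<subseteq> S. g R))"
      using form_bound(2)[OF r, of "\<lambda>S. p S l"] by simp }
qed

text \<open>The right side mentions neither \<open>p\<close> nor \<open>d\<close>, which gives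
  uniqueness. By bilinearity it suffices to find the inner products of the vectors attached to
  points.\<close>

lemma gram_determined:
  assumes r: "0 < r" "2 * r + 1 \<le> rk E"
    and C: "C = - 1 / (opt r - 1)" and N1: "N1 = cnt 1 r 0 0"
    and unit: "\<And>S. S \<in> flats r \<Longrightarrow> dot d (p S) (p S) = 1"
    and edge: "\<And>S T. S \<in> flats r \<Longrightarrow> T \<in> flats r \<Longrightarrow> S \<inter> T = B \<Longrightarrow> dot d (p S) (p T) \<le> - 1 / (opt r - 1)"
    and ST: "S \<in> flats r" "T \<in> flats r"
  shows "dot d (p S) (p T) = (\<Sum>P | P \<in> flats 1 \<and> P \<subseteq> S. \<Sum>Q | Q \<in> flats 1 \<and> Q \<subseteq> T.
    if P = Q then - (real (card (flats 1)) - 1) * (C / N1 / N1) else C / N1 / N1)"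
proof -
  have t: "1 < opt r" using two_le_opt[OF r] by simp
  have eq: "dot d (p S) (p T) = C" if "S \<in> flats r" "T \<in> flats r" "S \<inter> T = B" for S T
    unfolding C by (rule coloring_bound(2)[OF r t unit edge refl that])
  have "\<forall>l\<in>{..<d}. \<exists>g. harmonic 1 g \<and> (\<forall>S\<in>flats r. p S l = (\<Sum>R | R \<in> flats 1 \<and> R \<subseteq> S. g R))"
    using coloring_bound(3)[OF r t unit edge refl] by simp
  then obtain G where G: "\<And>l. l < d \<Longrightarrow> harmonic 1 (G l)"
    "\<And>l S. l < d \<Longrightarrow> S \<in> flats r \<Longrightarrow> p S l = (\<Sum>R | R \<in> flats 1 \<and> R \<subseteq> S. G l R)"
    by (metis bchoice lessThan_iff)
  define c where "c P l = G l P" for P l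
  have split: "dot d (p S) y = (\<Sum>P | P \<in> flats 1 \<and> P \<subseteq> S. dot d (c P) y)" if "S \<in> flats r" for S y
    by (rule dot_sum_left) (simp add: G that c_def)
  have split': "dot d y (p S) = (\<Sum>P | P \<in> flats 1 \<and> P \<subseteq> S. dot d y (c P))" if "S \<in> flats r" for S y
    using split[OF that] by (simp add: dot_commute[of d y])
  \<comment> \<open>First use of the hyperplane sums: \<open>T\<close> is fixed and the other end of
    the edge varies.\<close>
  have point_flat: "dot d (c P) (p T) = C / N1" if "P \<in> flats 1" "T \<in> flats r" "P \<inter> T = B" for P T
    unfolding N1
  proof (rule hyperplane_sums_determine[OF r(1), where W = T and \<phi> = "\<lambda>P. dot d (c P) (p T)" and P = P])
    show "T \<in> L" "rk T + r + 1 \<le> rk E" using that r by (auto simp: flats_def)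
    show "(\<Sum>P | P \<in> flats 1 \<and> P \<subseteq> U. dot d (c P) (p T)) = C" if "U \<in> flats r" "U \<inter> T = B" for U
      using split[OF that(1), of "p T"] eq[of U T] that \<open>T \<in> flats r\<close> by simp
  qed (use that in auto)
  \<comment> \<open>Second use: \<open>P\<close> is fixed, and \<open>point_flat\<close> supplies
    the sums over the flats that meet \<open>P\<close> in \<open>B\<close>.\<close>
  have point_point: "dot d (c P) (c Q) = C / N1 / N1" if PQ: "P \<in> flats 1" "Q \<in> flats 1" "P \<noteq> Q" for P Q
  proof -
    have "dot d (c Q) (c P) = C / N1 / cnt 1 r 0 0"
    proof (rule hyperplane_sums_determine[OF r(1), where W = P and \<phi> = "\<lambda>Q. dot d (c Q) (c P)" and P = Q])
      show "P \<in> L" "rk P + r + 1 \<le> rk E" using PQ r by (auto simp: flats_def)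
      show "(\<Sum>Q | Q \<in> flats 1 \<and> Q \<subseteq> U. dot d (c Q) (c P)) = C / N1" if "U \<in> flats r" "U \<inter> P = B" for U
        using split[OF that(1), of "c P"] point_flat[OF PQ(1) that(1)] that
        by (simp add: dot_commute[of d "c P"] Int_commute)
    qed (use PQ points_Int[of Q P] in auto)
    then show ?thesis by (simp add: N1 dot_commute)
  qed
  \<comment> \<open>Harmonicity at \<open>B\<close> says that the vectors \<open>c Q\<close> sum to
    zero; in the inner product with \<open>c P\<close> only the diagonal term is unknown.\<close>
  have self: "dot d (c P) (c P) = - (real (card (flats 1)) - 1) * (C / N1 / N1)" if P: "P \<in> flats 1" for P
  proof -
    have "(\<Sum>Q\<in>flats 1. G l Q) = 0" if "l < d" for l
    proof -
      have "{Q. Q \<in> flats 1 \<and> B \<subseteq> Q} = flats 1" using B_le by (auto simp: flats_def)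
      then show ?thesis using G(1)[OF that] B_in rk_B by (auto simp: harmonic_def)
    qed
    then have "0 = (\<Sum>Q\<in>flats 1. dot d (c Q) (c P))"
      using dot_sum_left[where x = "\<lambda>_. 0" and X = "flats 1" and c = c and y = "c P" and d = d] by (simp add: c_def dot_def)
    also have "\<dots> = dot d (c P) (c P) + (\<Sum>Q\<in>flats 1 - {P}. dot d (c Q) (c P))"
      by (rule sum.remove) (use P in auto)
    also have "(\<Sum>Q\<in>flats 1 - {P}. dot d (c Q) (c P)) = (\<Sum>Q\<in>flats 1 - {P}. C / N1 / N1)"
      using point_point P by (intro sum.cong) auto
    also have "\<dots> = (real (card (flats 1)) - 1) * (C / N1 / N1)"
    proof -
      have "0 < card (flats 1)" using P by (auto simp: card_gt_0_iff)
      then show ?thesis using P by (simp add: card_Diff_singleton of_nat_diff)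
    qed
    finally show ?thesis unfolding mult_minus_left by linarith
  qed
  have "dot d (p S) (p T) = (\<Sum>P | P \<in> flats 1 \<and> P \<subseteq> S. \<Sum>Q | Q \<in> flats 1 \<and> Q \<subseteq> T. dot d (c P) (c Q))"
    unfolding split[OF ST(1), of "p T"] by (intro sum.cong refl split'[OF ST(2)])
  also have "\<dots> = (\<Sum>P | P \<in> flats 1 \<and> P \<subseteq> S. \<Sum>Q | Q \<in> flats 1 \<and> Q \<subseteq> T.
      if P = Q then - (real (card (flats 1)) - 1) * (C / N1 / N1) else C / N1 / N1)"
    by (intro sum.cong refl) (auto simp: self point_point)
  finally show ?thesis .
qed

section \<open>The optimal coloring and uniqueness\<close>

definition disjointness_graph :: "nat \<Rightarrow> 'a set pair_pre_digraph" where
  "disjointness_graph r =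
    \<lparr> pverts = flats r, parcs = {(S, T). S \<in> flats r \<and> T \<in> flats r \<and> S \<inter> T = B} \<rparr>"

lemma vector_coloring_iff:
  "vector_coloring (disjointness_graph r) t d p \<longleftrightarrow> 2 \<le> t \<and>
    (\<forall>S\<in>flats r. dot d (p S) (p S) = 1) \<and>
    (\<forall>S\<in>flats r. \<forall>T\<in>flats r. S \<inter> T = B \<longrightarrow> dot d (p S) (p T) \<le> - 1 / (t - 1))"
  by (auto simp: vector_coloring_def disjointness_graph_def)

text \<open>The coloring consists of the normalized projections of the indicator vectors to sum zero.\<close>

lemma opt_attained:
  assumes r: "0 < r" "2 * r + 1 \<le> rk E"
  shows "\<exists>d p. vector_coloring (disjointness_graph r) (opt r) d p"
proof -
  \<comment> \<open>Without \<open>B\<close>, which is the zero vector in the subspace case, flats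
    that meet in \<open>B\<close> have indicator vectors with disjoint supports.\<close>
  define X where "X = E - B"
  have finX: "finite X" using finite_E by (simp add: X_def)
  define N K where "N = real (s (rk E)) - real (s 0)" and "K = real (s r) - real (s 0)"
  have card_minus: "real (card (S - B)) = real (s (rk S)) - real (s 0)" if "S \<in> L" for S
  proof -
    have "card (S - B) = card S - card B"
      using B_le[OF that] B_in finite_flat by (intro card_Diff_subset) auto
    then show ?thesis using card_flat that B_in rk_B by (simp add: of_nat_diff)
  qed
  have NK: "0 < K" "K < N" using r by (auto simp: N_def K_def)
  define n where "n = card X"
  have n: "real n = N" using card_minus[OF E_in] by (simp add: n_def X_def N_def)
  obtain e where e: "bij_betw e {..<n} X"
    using ex_bij_betw_nat_finite[OF finX] by (auto simp: n_def lessThan_atLeast0)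
  \<comment> \<open>The squared norm of an indicator vector with \<open>K\<close> ones among
    \<open>N\<close> coordinates after its mean \<open>K / N\<close> is subtracted.\<close>
  define v where "v = K - K * K / N"
  have v: "0 < v" using NK by (simp add: v_def field_simps)
  define p where "p S i = (of_bool (e i \<in> S) - K / N) / sqrt v" for S i
  have dotp: "dot n (p S) (p T) = (real (card (S \<inter> T - B)) - K * K / N) / v"
    if S: "S \<in> flats r" and T: "T \<in> flats r" for S T
  proof -
    have ind: "(\<Sum>x\<in>X. of_bool (x \<in> S)) = K" if "S \<in> flats r" for S
    proof -
      have "X \<inter> S = S - B" using le_E that by (auto simp: X_def flats_def)
      then show ?thesis using that card_minus[of S] finX by (simp add: K_def flats_def Int_def)
    qed
    have ind2: "(\<Sum>x\<in>X. of_bool (x \<in> S) * of_bool (x \<in> T)) = real (card (S \<inter> T - B))"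
    proof -
      have "X \<inter> {x. x \<in> S \<and> x \<in> T} = S \<inter> T - B" using le_E S by (auto simp: X_def flats_def)
      then show ?thesis using finX by (simp flip: of_bool_conj)
    qed
    have "dot n (p S) (p T) = (\<Sum>x\<in>X. (of_bool (x \<in> S) - K / N) / sqrt v * ((of_bool (x \<in> T) - K / N) / sqrt v))"
      unfolding dot_def p_def using e by (rule sum.reindex_bij_betw)
    also have "\<dots> = (\<Sum>x\<in>X. of_bool (x \<in> S) * of_bool (x \<in> T) - K / N * of_bool (x \<in> S)
        - K / N * of_bool (x \<in> T) + K / N * (K / N)) / v"
      using v unfolding sum_divide_distrib
      by (intro sum.cong refl) (simp add: algebra_simps diff_divide_distrib add_divide_distrib)
    also have "\<dots> = (real (card (S \<inter> T - B)) - K / N * K - K / N * K + real n * (K / N * (K / N))) / v"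
      by (simp only: sum.distrib sum_subtractf sum_distrib_left[symmetric] ind[OF S] ind[OF T] ind2
          n_def sum_constant) (simp add: mult_ac)
    also have "real n * (K / N * (K / N)) = K / N * K" using NK by (simp add: n)
    finally show ?thesis by simp
  qed
  have "dot n (p S) (p S) = 1" if "S \<in> flats r" for S
    using dotp[OF that that] card_minus[of S] that v by (simp add: K_def v_def flats_def)
  moreover have "dot n (p S) (p T) \<le> - 1 / (opt r - 1)" if "S \<in> flats r" "T \<in> flats r" "S \<inter> T = B" for S T
  proof -
    have "opt r - 1 = (N - K) / K" using opt_minus_1(2)[OF r] by (simp add: N_def K_def)
    moreover have "dot n (p S) (p T) = - (K * K / N) / v" using dotp that by simp
    moreover have "- (K * K / N) / v = - 1 / ((N - K) / K)"
      using NK v by (simp add: v_def field_simps)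
    ultimately show ?thesis by simp
  qed
  ultimately show ?thesis
    using two_le_opt[OF r] by (auto simp: vector_coloring_iff)
qed

theorem uniquely_vector_colorable_disjointness_graph:
  assumes r: "0 < r" "2 * r + 1 \<le> rk E"
  shows "uniquely_vector_colorable (disjointness_graph r)"
proof -
  have "vector_chromatic_number (disjointness_graph r) = opt r"
    unfolding vector_chromatic_number_def
  proof (rule Least_equality)
    show "\<exists>d p. vector_coloring (disjointness_graph r) (opt r) d p" by (rule opt_attained[OF r])
    fix t assume "\<exists>d p. vector_coloring (disjointness_graph r) t d p"
    then obtain d p where "vector_coloring (disjointness_graph r) t d p" by blast
    then show "opt r \<le> t"
      unfolding vector_coloring_iff using coloring_bound(1)[OF r, of t d p] by simp
  qed
  then have "dot d (p S) (p T) = (\<Sum>P | P \<in> flats 1 \<and> P \<subseteq> S. \<Sum>Q | Q \<in> flats 1 \<and> Q \<subseteq> T.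
      if P = Q then - (real (card (flats 1)) - 1) * (- 1 / (opt r - 1) / cnt 1 r 0 0 / cnt 1 r 0 0)
      else - 1 / (opt r - 1) / cnt 1 r 0 0 / cnt 1 r 0 0)"
    if "optimal_vector_coloring (disjointness_graph r) d p" "S \<in> flats r" "T \<in> flats r" for d p S T
    using gram_determined[OF r refl refl _ _ that(2,3), of d p] that(1)
    unfolding optimal_vector_coloring_def vector_coloring_iff by simp
  then show ?thesis
    unfolding uniquely_vector_colorable_def by (simp add: disjointness_graph_def)
qed

end

subsection \<open>Subsets and subspaces\<close>

lemma modular_geometry_subsets:
  "modular_geometry (Pow {1..n :: nat}) {} {1..n} card (\<union>) (\<lambda>v. {v}) id 1 1"
proof
  show "card (S \<inter> T) + card (S \<union> T) = card S + card T"
    if "S \<in> Pow {1..n}" "T \<in> Pow {1..n}" for S T :: "nat set"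
    using that card_Un_Int[of S T] finite_subset[of _ "{1..n}"] by auto
qed auto

text \<open>Induction over a basis: independence makes a vector in the span of
  \<open>insert x X\<close> the same as a coefficient of \<open>x\<close> together with a vector in
  the span of \<open>X\<close>.\<close>

lemma card_vec_subspace:
  fixes U :: "('f :: {field, finite} ^ 'n :: finite) set"
  assumes "vec.subspace U"
  shows "card U = CARD('f) ^ vec.dim U"
proof -
  have "card (vec.span X) = CARD('f) ^ card X"
    if "finite X" "vec.independent X" for X :: "('f ^ 'n) set"
    using that
  proof (induction X)
    case empty
    then show ?case by simp
  next
    case (insert x X)
    have x: "x \<notin> vec.span X" and X: "vec.independent X"
      using insert by (simp_all add: vec.independent_insert)
    have "bij_betw (\<lambda>(k, y). k *s x + y) (UNIV \<times> vec.span X) (vec.span (insert x X))"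
    proof (rule bij_betw_imageI)
      show "inj_on (\<lambda>(k, y). k *s x + y) (UNIV \<times> vec.span X)"
      proof (rule inj_onI, clarify)
        fix k y l z assume yz: "y \<in> vec.span X" "z \<in> vec.span X" and eq: "k *s x + y = l *s x + z"
        have d: "(k - l) *s x = z - y" using eq by (simp add: vec.scale_left_diff_distrib algebra_simps)
        have "k = l"
        proof (rule ccontr)
          assume "k \<noteq> l"
          then have "x = inverse (k - l) *s ((k - l) *s x)"
            unfolding vec.scale_scale by simp
          also have "\<dots> \<in> vec.span X" unfolding d using yz by (intro vec.span_scale vec.span_diff)
          finally show False using x by blast
        qed
        then show "k = l \<and> y = z" using eq by simp
      qed
      show "(\<lambda>(k, y). k *s x + y) ` (UNIV \<times> vec.span X) = vec.span (insert x X)"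
      proof (intro set_eqI iffI)
        fix v assume "v \<in> (\<lambda>(k, y). k *s x + y) ` (UNIV \<times> vec.span X)"
        then obtain k y where "y \<in> vec.span X" and v: "v = k *s x + y" by auto
        then have "v - k *s x \<in> vec.span X" by simp
        then show "v \<in> vec.span (insert x X)" by (auto simp: vec.span_insert)
      next
        fix v assume "v \<in> vec.span (insert x X)"
        then obtain k where "v - k *s x \<in> vec.span X" by (auto simp: vec.span_insert)
        then show "v \<in> (\<lambda>(k, y). k *s x + y) ` (UNIV \<times> vec.span X)"
          by (intro image_eqI[of _ _ "(k, v - k *s x)"]) auto
      qed
    qed
    then have "card (vec.span (insert x X)) = CARD('f) * card (vec.span X)"
      by (simp add: bij_betw_same_card[symmetric] card_cartesian_product)
    then show ?case using insert X by simp
  qed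
  moreover obtain X where "X \<subseteq> U" "vec.independent X" "U \<subseteq> vec.span X" "card X = vec.dim U"
    using vec.basis_exists[of U] by blast
  moreover have "vec.span X = U"
    using calculation assms by (metis vec.span_subspace)
  ultimately show ?thesis by (metis finite)
qed

text \<open>The join is the sum of subspaces, and modularity is the dimension formula for sums and
  intersections.\<close>

lemma modular_geometry_subspaces:
  "modular_geometry {U :: ('f :: {field, finite} ^ 'n :: finite) set. vec.subspace U} {0} UNIV vec.dim
    (\<lambda>U W. {x + y | x y. x \<in> U \<and> y \<in> W}) (\<lambda>v. vec.span {v}) (\<lambda>i. CARD('f) ^ i)
    (CARD('f) - 1) CARD('f)"
proof
  have "CARD('f) \<ge> 2"
  proof -
    have "card {0, 1 :: 'f} \<le> CARD('f)" by (intro card_mono) auto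
    then show ?thesis by simp
  qed
  then show "0 < CARD('f) - 1" "0 < CARD('f)" by auto
  then show "CARD('f) ^ Suc i = CARD('f) ^ i + (CARD('f) - 1) * CARD('f) ^ i" for i
    by (simp add: algebra_simps flip: power_Suc)
next
  fix S T :: "('f ^ 'n) set"
  assume ST: "S \<in> {U. vec.subspace U}" "T \<in> {U. vec.subspace U}"
  show "S \<inter> T \<in> {U. vec.subspace U}" using ST by (simp add: vec.subspace_inter)
  show "{x + y | x y. x \<in> S \<and> y \<in> T} \<in> {U. vec.subspace U}"
    using ST by (simp add: vec.subspace_sums)
  show "S \<subseteq> {x + y | x y. x \<in> S \<and> y \<in> T}"
    using ST vec.subspace_0[of T] by force
  show "T \<subseteq> {x + y | x y. x \<in> S \<and> y \<in> T}"
    using ST vec.subspace_0[of S] by force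
  show "vec.dim (S \<inter> T) + vec.dim {x + y | x y. x \<in> S \<and> y \<in> T} = vec.dim S + vec.dim T"
    using ST vec.dim_sums_Int[of S T] by simp
  show "{x + y | x y. x \<in> S \<and> y \<in> T} \<subseteq> U"
    if "U \<in> {U. vec.subspace U}" "S \<subseteq> U" "T \<subseteq> U" for U
    using that vec.subspace_add by blast
qed (auto simp: vec.subspace_0 vec.span_base card_vec_subspace vec.span_minimal)

theorem theorem4p8:
  fixes n r q :: nat
  assumes "0 < n" and "0 < r" and "n \<ge> 2 * r + 1" and "primepow q"
  shows "uniquely_vector_colorable (kneser_graph n r) \<and>
    (CARD('f) = q \<and> CARD('n) = n \<longrightarrow>
      uniquely_vector_colorable
        (q_kneser_graph r :: (('f :: {field, finite}) ^ 'n :: finite) set pair_pre_digraph))"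
proof (intro conjI impI)
  interpret sets: modular_geometry "Pow {1..n}" "{}" "{1..n}" card "(\<union>)" "\<lambda>v. {v}" id 1 1
    by (rule modular_geometry_subsets)
  have "kneser_graph n r = sets.disjointness_graph r"
    unfolding kneser_graph_def sets.disjointness_graph_def sets.flats_def Let_def by simp
  then show "uniquely_vector_colorable (kneser_graph n r)"
    using sets.uniquely_vector_colorable_disjointness_graph assms by simp
next
  assume card: "CARD('f) = q \<and> CARD('n) = n"
  interpret spaces: modular_geometry "{U :: ('f ^ 'n) set. vec.subspace U}" "{0}" UNIV vec.dim
    "\<lambda>U W. {x + y | x y. x \<in> U \<and> y \<in> W}" "\<lambda>v. vec.span {v}" "\<lambda>i. CARD('f) ^ i"
    "CARD('f) - 1" "CARD('f)"
    by (rule modular_geometry_subspaces)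
  have "2 * r + 1 \<le> vec.dim (UNIV :: ('f ^ 'n) set)"
    unfolding vec_dim_card using assms card by blast
  then have "uniquely_vector_colorable (spaces.disjointness_graph r)"
    using assms by (intro spaces.uniquely_vector_colorable_disjointness_graph)
  moreover have "(q_kneser_graph r :: ('f ^ 'n) set pair_pre_digraph) = spaces.disjointness_graph r"
    unfolding q_kneser_graph_def spaces.disjointness_graph_def spaces.flats_def Let_def by simp
  ultimately show "uniquely_vector_colorable (q_kneser_graph r :: ('f ^ 'n) set pair_pre_digraph)"
    by simp
qed

end
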